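(* Let $d$ be the dimension, $\epsilon=1/(48d^2\sqrt d)$, and $\delta\in[0,1]$. Any deterministic algorithm (in the memory-constrained model below) that is guaranteed to solve the feasibility problem over the unit ball with accuracy $\epsilon$ either uses at least $d^{2-\delta}$ bits of memory, or makes at least $\tilde\Omega(d^{1+\delta})$ queries (on some instance).
   Context: $B_d(\mathbf x,r)=\{\mathbf x'\in\mathbb{R}^d:\|\mathbf x-\mathbf x'\|_2\le r\}$. In the feasibility problem there is an unknown convex set $Q\subset B_d(0,1)$, accessed via a separation oracle: for a query $\mathbf x\in\mathbb{R}^d$ it either returns $\mathsf{Success}$ (meaning $\mathbf x\in Q$) or returns a vector $\mathbf g\in\mathbb{R}^d$ with $\langle\mathbf g,\mathbf x-\mathbf x'\rangle>0$ for all $\mathbf x'\in Q$. An algorithm solves the feasibility problem with accuracy $\epsilon$ if it finds a point of $Q$ for every such instance for which there exists $\mathbf x^\star\in B_d(0,1)$ with $B_d(\mathbf x^\star,\epsilon)\subset Q$. An $M$-bit memory-constrained deterministic algorithm with access to an oracle $\mathcal O:\mathcal S\to\mathcal R$ is specified by a query function $\psi_{query}:\{0,1\}^M\to\mathcal S$ and an update function $\psi_{update}:\{0,1\}^M\times\mathcal S\times\mathcal R\to\{0,1\}^M$; it starts with memory $0^M$, at iteration $t$ queries $q_t=\psi_{query}(\mathsf{Memory}_{t-1})$, receives $r_t=\mathcal O(q_t)$ and sets $\mathsf{Memory}_t=\psi_{update}(\mathsf{Memory}_{t-1},q_t,r_t)$ (internal computations are unrestricted in memory); its last query is its output. $\tilde\Omega(\cdot)$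 hides universal constants and polylogarithmic factors in $d$ (asymptotic in $d$). *)

theory Defs
  imports Complex_Main
begin

definition Rd :: "nat \<Rightarrow> (nat \<Rightarrow> real) set" where
  "Rd d = {x. \<forall>i\<ge>d. x i = 0}"

definition ip :: "nat \<Rightarrow> (nat \<Rightarrow> real) \<Rightarrow> (nat \<Rightarrow> real) \<Rightarrow> real" where
  "ip d x y = (\<Sum>i<d. x i * y i)"

definition enorm :: "nat \<Rightarrow> (nat \<Rightarrow> real) \<Rightarrow> real" where
  "enorm d x = sqrt (\<Sum>i<d. (x i)^2)"

definition Ball_d :: "nat \<Rightarrow> (nat \<Rightarrow> real) \<Rightarrow> real \<Rightarrow> (nat \<Rightarrow> real) set" where
  "Ball_d d x r = {x' \<in> Rd d. enorm d (\<lambda>i. x i - x' i) \<le> r}"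

definition convex_d :: "nat \<Rightarrow> (nat \<Rightarrow> real) set \<Rightarrow> bool" where
  "convex_d d Q \<longleftrightarrow> Q \<subseteq> Rd d \<and>
     (\<forall>x\<in>Q. \<forall>y\<in>Q. \<forall>t::real. 0 \<le> t \<and> t \<le> 1 \<longrightarrow> (\<lambda>i. (1 - t) * x i + t * y i) \<in> Q)"

text \<open>Separation oracle for Q: None encodes Success.\<close>
definition sep_oracle :: "nat \<Rightarrow> (nat \<Rightarrow> real) set \<Rightarrow> ((nat \<Rightarrow> real) \<Rightarrow> (nat \<Rightarrow> real) option) \<Rightarrow> bool" where
  "sep_oracle d Q Orc \<longleftrightarrow>
     (\<forall>x\<in>Rd d. (Orc x = None \<and> x \<in> Q) \<or>
        (\<exists>g\<in>Rd d. Orc x = Some g \<and> (\<forall>x'\<in>Q. ip d g (\<lambda>i. x i - x' i) > 0)))"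

definition feas_instance :: "nat \<Rightarrow> real \<Rightarrow> (nat \<Rightarrow> real) set \<Rightarrow> ((nat \<Rightarrow> real) \<Rightarrow> (nat \<Rightarrow> real) option) \<Rightarrow> bool" where
  "feas_instance d eps Q Orc \<longleftrightarrow>
     convex_d d Q \<and> Q \<subseteq> Ball_d d (\<lambda>_. 0) 1 \<and>
     (\<exists>xs\<in>Ball_d d (\<lambda>_. 0) 1. Ball_d d xs eps \<subseteq> Q) \<and> sep_oracle d Q Orc"

definition mem_alg :: "nat \<Rightarrow> nat \<Rightarrow> (bool list \<Rightarrow> (nat \<Rightarrow> real))
     \<Rightarrow> (bool list \<Rightarrow> (nat \<Rightarrow> real) \<Rightarrow> (nat \<Rightarrow> real) option \<Rightarrow> bool list) \<Rightarrow> bool" where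
  "mem_alg d M qry upd \<longleftrightarrow>
     (\<forall>m. length m = M \<longrightarrow> qry m \<in> Rd d) \<and>
     (\<forall>m q r. length m = M \<longrightarrow> length (upd m q r) = M)"

text \<open>Memory after t iterations (Memory_t); the (t+1)-st query is qry (mem_state ... t).\<close>
primrec mem_state :: "nat \<Rightarrow> (bool list \<Rightarrow> (nat \<Rightarrow> real))
     \<Rightarrow> (bool list \<Rightarrow> (nat \<Rightarrow> real) \<Rightarrow> (nat \<Rightarrow> real) option \<Rightarrow> bool list)
     \<Rightarrow> ((nat \<Rightarrow> real) \<Rightarrow> (nat \<Rightarrow> real) option) \<Rightarrow> nat \<Rightarrow> bool list" where
  "mem_state M qry upd Orc 0 = replicate M False"
| "mem_state M qry upd Orc (Suc t) =
     (let m = mem_state M qry upd Orc t; q = qry m in upd m q (Orc q))"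

definition query_at where
  "query_at M qry upd Orc t = qry (mem_state M qry upd Orc t)"

definition solves_feas :: "nat \<Rightarrow> real \<Rightarrow> nat \<Rightarrow> (bool list \<Rightarrow> (nat \<Rightarrow> real))
     \<Rightarrow> (bool list \<Rightarrow> (nat \<Rightarrow> real) \<Rightarrow> (nat \<Rightarrow> real) option \<Rightarrow> bool list) \<Rightarrow> bool" where
  "solves_feas d eps M qry upd \<longleftrightarrow>
     (\<forall>Q Orc. feas_instance d eps Q Orc \<longrightarrow>
        (\<exists>t. query_at M qry upd Orc t \<in> Q))"

end

theory Submission
  imports Defs "HOL-Analysis.L2_Norm" "HOL-Library.FuncSet"
begin

text \<open>
  Split the coordinates as $x = (y, z, \ldots)$ with $y, z \in \mathbb{R}^n$, $n = \lfloor d/2 \rfloor$.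
  A hidden integer matrix $B$ imposes the constraints $|z_i + \langle b_i, y\rangle / (nG)| \le \eta$.
  A query in the unit ball that violates no row and no earlier cut is called exploratory; the
  adversary answers it with a new cut $\langle v, x\rangle \le -\gamma$, where $v$ is a rounded unit
  vector $u$ orthogonal to the exploratory queries and cuts of the current period. A period consists
  of $k \approx d^{1-\delta}$ exploratory queries, and its cuts live in $2k$ coordinates of $y$
  reserved for it. With at most $kP \le n/2$ cuts the body still contains an $\varepsilon$-ball,
  because the $u$'s are orthonormal and $z$ can be solved for exactly.

  If the algorithm finished all $P$ periods within $Pn/2$ queries for every $B$, then each $B$ would
  have a period of at most $n/2$ queries, revealing at most $n/2$ rows. The memory content and the
  (rounded) cuts at the start of that period together with the revealed rows determine its
  exploratory queries, and each of these queries halves the number of candidates for every row that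
  was not revealed. So about $kn/4$ bits would be contained in a code of
  $M + O(n + k^2 P \log d)$ bits, which is impossible if $k$ is a large multiple of $M/n$ and
  $P$ is about $n / (k \log d)$. Hence some $B$ forces $Pn/2$ queries, which is of order
  $d^{1+\delta} / \log d$.
\<close>

subsection \<open>Euclidean vectors as functions\<close>

type_synonym vec = "nat \<Rightarrow> real"

lemma enorm_eq_L2_set: "enorm d x = L2_set x {..<d}"
  by (simp add: enorm_def L2_set_def)

lemma abs_ip_le: "\<bar>ip d x y\<bar> \<le> enorm d x * enorm d y"
proof -
  have "\<bar>ip d x y\<bar> \<le> (\<Sum>i<d. \<bar>x i\<bar> * \<bar>y i\<bar>)"
    unfolding ip_def by (rule order_trans[OF sum_abs]) (simp add: abs_mult)
  then show ?thesis
    using L2_set_mult_ineq[of x y "{..<d}"] by (simp add: enorm_eq_L2_set)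
qed

lemma enorm_nonneg: "0 \<le> enorm d x"
  by (simp add: enorm_eq_L2_set)

lemma ip_self: "ip d x x = (enorm d x)\<^sup>2"
  unfolding ip_def enorm_def by (simp add: sum_nonneg power2_eq_square)

lemma ip_commute: "ip d x y = ip d y x"
  unfolding ip_def by (simp add: mult.commute)

lemma ip_diff_right: "ip d x (\<lambda>i. y i - z i) = ip d x y - ip d x z"
  unfolding ip_def by (simp add: right_diff_distrib sum_subtractf)

lemma ip_cmult_left: "ip d (\<lambda>i. c * x i) y = c * ip d x y"
  unfolding ip_def by (simp add: sum_distrib_left mult.assoc)

lemma ip_convex_right:
  "ip d x (\<lambda>i. (1 - t) * y i + t * z i) = (1 - t) * ip d x y + t * ip d x z"
  unfolding ip_def by (simp add: sum.distrib distrib_left sum_distrib_left mult.left_commute)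

lemma ip_sum_right: "ip d x (\<lambda>i. \<Sum>j\<in>A. f j i) = (\<Sum>j\<in>A. ip d x (f j))"
  unfolding ip_def by (simp add: sum_distrib_left) (rule sum.swap)

lemma abs_coord_le_enorm:
  assumes "i < d"
  shows "\<bar>x i\<bar> \<le> enorm d x"
proof -
  have "\<bar>x i\<bar> \<le> L2_set (\<lambda>i. \<bar>x i\<bar>) {..<d}"
    using assms by (intro member_le_L2_set) auto
  also have "\<dots> = L2_set x {..<d}"
    by (simp add: L2_set_def)
  finally show ?thesis
    by (simp add: enorm_eq_L2_set)
qed

lemma enorm_triangle: "enorm d (\<lambda>i. x i + y i) \<le> enorm d x + enorm d y"
  by (simp add: enorm_eq_L2_set L2_set_triangle_ineq)

lemma enorm_cmult: "enorm d (\<lambda>i. c * x i) = \<bar>c\<bar> * enorm d x"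
  unfolding enorm_def by (simp add: power_mult_distrib real_sqrt_mult flip: sum_distrib_left)

lemma enorm_le_1_convex:
  assumes "enorm d x \<le> 1" "enorm d y \<le> 1" "0 \<le> t" "t \<le> 1"
  shows "enorm d (\<lambda>i. (1 - t) * x i + t * y i) \<le> 1"
proof -
  have "enorm d (\<lambda>i. (1 - t) * x i + t * y i) \<le> (1 - t) * enorm d x + t * enorm d y"
    using enorm_triangle[of d "\<lambda>i. (1 - t) * x i" "\<lambda>i. t * y i"] assms
    by (simp add: enorm_cmult)
  also have "\<dots> \<le> (1 - t) * 1 + t * 1"
    using assms by (intro add_mono mult_left_mono) auto
  finally show ?thesis by simp
qed

lemma ip_supported:
  assumes "\<And>i. i \<notin> A \<Longrightarrow> u i = 0" "A \<subseteq> {..<d}"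
  shows "ip d u x = (\<Sum>i\<in>A. u i * x i)"
  unfolding ip_def using assms by (intro sum.mono_neutral_right) auto

lemma sum_lessThan_add:
  fixes f :: "nat \<Rightarrow> 'a::comm_monoid_add"
  shows "(\<Sum>i<a + b. f i) = (\<Sum>i<a. f i) + (\<Sum>i<b. f (a + i))"
  by (induction b) (simp_all add: add.assoc)

section \<open>Linear algebra: more unknowns than homogeneous equations\<close>

text \<open>Gaussian elimination, by induction on the number of equations. The unknowns are an
  arbitrary coordinate set \<open>A\<close> because the directions of a period have to live in its
  own block.\<close>

lemma homogeneous_system_nontrivial:
  fixes fs :: "vec list"
  assumes "finite A" "length fs < card A"
  shows "\<exists>u. (\<forall>i. i \<notin> A \<longrightarrow> u i = 0) \<and> (\<exists>i\<in>A. u i \<noteq> 0) \<and> (\<forall>f\<in>set fs. (\<Sum>i\<in>A. u i * f i) = 0)"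
  using assms
proof (induction "length fs" arbitrary: fs A)
  case 0
  then obtain a where "a \<in> A" by fastforce
  with 0 show ?case
    by (intro exI[of _ "\<lambda>i. if i = a then 1 else 0"]) auto
next
  case (Suc m)
  then obtain f gs where fs: "fs = f # gs" by (cases fs) auto
  show ?case
  proof (cases "\<forall>i\<in>A. f i = 0")
    case True
    obtain u where "\<forall>i. i \<notin> A \<longrightarrow> u i = 0" "\<exists>i\<in>A. u i \<noteq> 0"
      "\<forall>f\<in>set gs. (\<Sum>i\<in>A. u i * f i) = 0"
      using Suc.hyps(1)[of gs A] Suc.hyps(2) Suc.prems fs by auto
    with True fs show ?thesis by auto
  next
    case False
    then obtain a where a: "a \<in> A" "f a \<noteq> 0" by auto
    define A' where "A' = A - {a}"
    \<comment> \<open>Subtracting this multiple of \<open>f\<close> makes the coefficient at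
      \<open>a\<close> vanish, so the reduced equations live on \<open>A'\<close>.\<close>
    define hs where "hs = map (\<lambda>g i. g i - g a / f a * f i) gs"
    obtain u where u: "\<forall>i. i \<notin> A' \<longrightarrow> u i = 0" "\<exists>i\<in>A'. u i \<noteq> 0"
      "\<forall>g\<in>set hs. (\<Sum>i\<in>A'. u i * g i) = 0"
    proof -
      have "length hs < card A'" "m = length hs" "finite A'"
        using Suc.hyps(2) Suc.prems fs a by (auto simp: hs_def A'_def)
      then show thesis
        using Suc.hyps(1)[of hs A'] that by blast
    qed
    \<comment> \<open>The value at \<open>a\<close> is the one that solves the equation
      \<open>f\<close>; the other equations then follow from the reduced ones.\<close>
    define w where "w = u(a := - (\<Sum>i\<in>A'. u i * f i) / f a)"
    have split: "(\<Sum>i\<in>A. w i * g i) = w a * g a + (\<Sum>i\<in>A'. u i * g i)" for g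
    proof -
      have "(\<Sum>i\<in>A. w i * g i) = w a * g a + (\<Sum>i\<in>A'. w i * g i)"
        unfolding A'_def by (rule sum.remove) (use a Suc.prems in auto)
      also have "(\<Sum>i\<in>A'. w i * g i) = (\<Sum>i\<in>A'. u i * g i)"
        by (intro sum.cong) (auto simp: w_def A'_def)
      finally show ?thesis .
    qed
    have "(\<Sum>i\<in>A. w i * g i) = 0" if g: "g \<in> set gs" for g
    proof -
      have "(\<Sum>i\<in>A'. u i * (g i - g a / f a * f i)) = 0"
        using u(3) g by (auto simp: hs_def)
      then have "(\<Sum>i\<in>A'. u i * g i) = g a / f a * (\<Sum>i\<in>A'. u i * f i)"
        by (simp add: right_diff_distrib sum_subtractf sum_distrib_left mult.left_commute)
      then show ?thesis
        unfolding split by (simp add: w_def)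
    qed
    moreover have "(\<Sum>i\<in>A. w i * f i) = 0"
      unfolding split using a by (simp add: w_def)
    ultimately show ?thesis
      using u(1,2) a fs by (intro exI[of _ w]) (auto simp: w_def A'_def)
  qed
qed

lemma unit_vector_orthogonal_to_few:
  assumes "A \<subseteq> {..<d}" "length fs < card A"
  shows "\<exists>u. (\<forall>i. i \<notin> A \<longrightarrow> u i = 0) \<and> ip d u u = 1 \<and> (\<forall>f\<in>set fs. ip d u f = 0)"
proof -
  have "finite A" using assms(1) finite_subset by blast
  from homogeneous_system_nontrivial[OF this assms(2)] obtain w where
    w: "\<And>i. i \<notin> A \<Longrightarrow> w i = 0" "\<exists>i\<in>A. w i \<noteq> 0" "\<forall>f\<in>set fs. (\<Sum>i\<in>A. w i * f i) = 0"
    by auto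
  have pos: "ip d w w > 0"
  proof -
    from w(2) obtain i where "i \<in> A" "w i \<noteq> 0" by auto
    then have "\<bar>w i\<bar> > 0" "i < d" using assms(1) by auto
    then have "enorm d w > 0" using abs_coord_le_enorm[of i d w] by linarith
    then show ?thesis by (simp add: ip_self)
  qed
  define c where "c = 1 / sqrt (ip d w w)"
  have c2: "c * c * ip d w w = 1"
    using pos by (simp add: c_def field_simps)
  have "ip d (\<lambda>i. c * w i) (\<lambda>i. c * w i) = 1"
    using c2 by (metis ip_cmult_left ip_commute mult.assoc)
  moreover have "\<forall>f\<in>set fs. ip d (\<lambda>i. c * w i) f = 0"
    using w(3) ip_supported[of A w d] w(1) assms(1) by (auto simp: ip_cmult_left)
  ultimately show ?thesis
    using w(1) by (intro exI[of _ "\<lambda>i. c * w i"]) auto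
qed

lemma abs_coord_le_1_of_unit:
  assumes "ip d u u = 1" "i < d"
  shows "\<bar>u i\<bar> \<le> 1"
proof -
  have "(enorm d u)\<^sup>2 = 1" using assms(1) by (simp add: ip_self)
  then have "enorm d u = 1" using enorm_nonneg[of d u] by (simp add: power2_eq_1_iff)
  then show ?thesis using abs_coord_le_enorm[OF assms(2), of u] by simp
qed

subsection \<open>The resisting oracle\<close>

locale hard_instance =
  fixes d n k P G M :: nat
    and qry :: "bool list \<Rightarrow> vec"
    and upd :: "bool list \<Rightarrow> vec \<Rightarrow> vec option \<Rightarrow> bool list"
  assumes n_pos: "0 < n" and n_le: "2 * n \<le> d" and k_pos: "0 < k" and P_pos: "0 < P"
    and kP_le: "2 * k * P \<le> n" and G_pos: "0 < G" and alg: "mem_alg d M qry upd"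
begin

definition eps :: real where "eps = 1 / (48 * real d ^ 2 * sqrt (real d))"
text \<open>Moving by \<open>eps\<close> from a point where a row vanishes changes the row by at
  most \<open>eps\<close> through its averaged \<open>y\<close>-part and by \<open>eps\<close>
  through its single \<open>z\<close>-coordinate.\<close>

definition row_tol :: real where "row_tol = 2 * eps"
text \<open>The centre of the inscribed ball has depth \<open>2 * cut_depth\<close> along every
  direction; one half of \<open>cut_depth\<close> is reserved for rounding the direction, the other
  for the radius of the ball.\<close>

definition cut_depth :: real where "cut_depth = 1 / (4 * sqrt (real d))"

text \<open>A fresh direction must be orthogonal to the current query and to at most
  \<open>k - 1\<close> earlier queries and \<open>k - 1\<close> earlier directions, at most
  \<open>2 * k - 1\<close> vectors in all.\<close>

definition blk :: "nat \<Rightarrow> nat set" where "blk p = {2 * k * p..<2 * k * p + 2 * k}"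

text \<open>For \<open>b j < G\<close> the \<open>y\<close>-part has entries at most
  \<open>1 / n\<close>, hence norm at most \<open>1 / sqrt n\<close>. The coefficient 1 at
  \<open>n + i\<close> gives each row a private coordinate. \<open>G\<close> is the resolution of
  the integer entries.\<close>

definition row :: "nat \<Rightarrow> (nat \<Rightarrow> nat) \<Rightarrow> vec" where
  "row i b = (\<lambda>j. if j < n then real (b j) / (real n * real G) else if j = n + i then 1 else 0)"

definition violates :: "nat set \<Rightarrow> (nat \<Rightarrow> nat \<Rightarrow> nat) \<Rightarrow> vec \<Rightarrow> nat \<Rightarrow> bool" where
  "violates I B x i \<longleftrightarrow> i \<in> I \<and> row_tol < \<bar>ip d (row i (B i)) x\<bar>"

definition cut :: "nat \<Rightarrow> (nat \<Rightarrow> nat) \<Rightarrow> vec \<Rightarrow> vec" where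
  "cut i b x = (\<lambda>j. sgn (ip d (row i b) x) * row i b j)"

text \<open>Ties are broken so that answers are stable: a cut appended at the end of
  \<open>V\<close> does not alter an answer already given, and neither does deleting rows other than
  the least violated one.\<close>

definition adv_oracle :: "nat set \<Rightarrow> (nat \<Rightarrow> nat \<Rightarrow> nat) \<Rightarrow> vec list \<Rightarrow> vec \<Rightarrow> vec option" where
  "adv_oracle I B V x =
    (if 1 < enorm d x then Some x
     else if \<exists>i. violates I B x i then (let i = LEAST i. violates I B x i in Some (cut i (B i) x))
     else List.find (\<lambda>v. - cut_depth < ip d v x) V)"

definition body :: "(nat \<Rightarrow> nat \<Rightarrow> nat) \<Rightarrow> vec list \<Rightarrow> vec set" where
  "body B V = {x \<in> Rd d. enorm d x \<le> 1 \<and> (\<forall>i<n. \<bar>ip d (row i (B i)) x\<bar> \<le> row_tol) \<and>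
     (\<forall>v\<in>set V. ip d v x \<le> - cut_depth)}"

text \<open>Rounding to this grid changes the inner product with a vector of entries at most 1 by at
  most \<open>d / grid = 1 / (8 * d)\<close>, while one coordinate still costs only
  \<open>O(log d)\<close> bits.\<close>

definition grid :: nat where "grid = 8 * d ^ 2"

definition round_grid :: "vec \<Rightarrow> vec" where
  "round_grid u = (\<lambda>i. real_of_int \<lfloor>real grid * u i\<rfloor> / real grid)"

definition fresh_direction :: "nat \<Rightarrow> (vec \<times> vec) list \<Rightarrow> vec \<Rightarrow> vec" where
  "fresh_direction p E x = (SOME u. (\<forall>i. i \<notin> blk p \<longrightarrow> u i = 0) \<and> ip d u u = 1 \<and>
     (\<forall>f\<in>set (x # map fst E @ map snd E). ip d u f = 0))"

text \<open>A state consists of the memory, the list of all cuts, and the pairs of a direction and an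
  exploratory query of the current period only; the third component is emptied as soon as a period
  ends, so that memory and cuts determine the state at the start of a period. The parameter \<open>I\<close>
  restricts the oracle to a subset of the rows.\<close>

definition adv_step :: "nat set \<Rightarrow> (nat \<Rightarrow> nat \<Rightarrow> nat) \<Rightarrow>
    bool list \<times> vec list \<times> (vec \<times> vec) list \<Rightarrow> bool list \<times> vec list \<times> (vec \<times> vec) list" where
  "adv_step I B = (\<lambda>(s, V, E). let q = qry s in
     case adv_oracle I B V q of
       Some r \<Rightarrow> (upd s q (Some r), V, E)
     | None \<Rightarrow> let u = fresh_direction (length V div k) E q in
         (upd s q (Some (round_grid u)), V @ [round_grid u], if Suc (length E) = k then [] else E @ [(u, q)]))"

definition run where "run I B st t = (adv_step I B ^^ t) st"

definition init :: "bool list \<times> vec list \<times> (vec \<times> vec) list" where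
  "init = (replicate M False, [], [])"

lemma run_0 [simp]: "run I B st 0 = st"
  and run_Suc: "run I B st (Suc t) = adv_step I B (run I B st t)"
  and run_add: "run I B st (s + t) = run I B (run I B st s) t"
  unfolding run_def by (simp_all add: add.commute[of s t] funpow_add)

section \<open>Numerical margins, rounding and fresh directions\<close>

lemma d_ge: "2 \<le> d" using n_pos n_le by linarith

lemma row_tol_pos: "0 < row_tol" and cut_depth_pos: "0 < cut_depth"
  using d_ge by (auto simp: eps_def row_tol_def cut_depth_def)

lemma sqrt_d_le: "sqrt (real d) \<le> real d"
  using d_ge by (simp add: real_le_lsqrt power2_eq_square)

lemma inverse_d_le: "1 / (8 * real d) \<le> cut_depth / 2"
  using d_ge sqrt_d_le by (simp add: cut_depth_def field_simps)

text \<open>This bounds the effect of moving every coordinate by \<open>eps\<close> on a cut whose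
  entries are at most 1.\<close>

lemma d_eps_le: "real d * eps \<le> cut_depth / 2"
proof -
  have "6 * sqrt (real d) \<le> real d * sqrt (real d) * 6"
    using d_ge by simp
  then show ?thesis
    using d_ge by (simp add: eps_def cut_depth_def field_simps power2_eq_square)
qed

lemma eps_le: "eps \<le> 1 / 8"
proof -
  have "1 \<le> real d ^ 2" "1 \<le> sqrt (real d)" using d_ge by auto
  then have "1 * 1 \<le> real d ^ 2 * sqrt (real d)" by (intro mult_mono) auto
  then show ?thesis by (simp add: eps_def field_simps)
qed

lemma blk_subset: "p < P \<Longrightarrow> blk p \<subseteq> {..<n}"
proof -
  assume "p < P"
  then have "2 * k * Suc p \<le> 2 * k * P" by (intro mult_le_mono) auto
  with kP_le have "2 * k * p + 2 * k \<le> n" by simp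
  then show ?thesis by (auto simp: blk_def)
qed

lemma blk_subset_d: "p < P \<Longrightarrow> blk p \<subseteq> {..<d}"
  using blk_subset[of p] n_le by fastforce

lemma card_blk: "card (blk p) = 2 * k" by (simp add: blk_def)

lemma blk_disjoint: "p < p' \<Longrightarrow> blk p \<inter> blk p' = {}"
proof -
  assume "p < p'"
  then have "2 * k * Suc p \<le> 2 * k * p'" by (intro mult_le_mono) auto
  then show ?thesis by (auto simp: blk_def)
qed

lemma grid_pos: "0 < grid" using d_ge by (simp add: grid_def)

lemma round_grid_zero: "u i = 0 \<Longrightarrow> round_grid u i = 0" by (simp add: round_grid_def)

lemma round_grid_close: "\<bar>round_grid u i - u i\<bar> \<le> 1 / real grid"
proof -
  have "\<bar>real_of_int \<lfloor>real grid * u i\<rfloor> - real grid * u i\<bar> \<le> 1" by linarith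
  then have "\<bar>real_of_int \<lfloor>real grid * u i\<rfloor> - real grid * u i\<bar> / real grid \<le> 1 / real grid"
    using grid_pos by (intro divide_right_mono) auto
  also have "\<bar>real_of_int \<lfloor>real grid * u i\<rfloor> - real grid * u i\<bar> / real grid
      = \<bar>(real_of_int \<lfloor>real grid * u i\<rfloor> - real grid * u i) / real grid\<bar>"
    by simp
  also have "(real_of_int \<lfloor>real grid * u i\<rfloor> - real grid * u i) / real grid = round_grid u i - u i"
    using grid_pos by (simp add: round_grid_def field_simps)
  finally show ?thesis .
qed

lemma floor_grid_bounds:
  assumes "\<bar>u i\<bar> \<le> 1"
  shows "\<lfloor>real grid * u i\<rfloor> \<in> {- int grid..int grid}"
proof -
  have "real grid * u i \<le> real grid * 1" "real grid * (-1) \<le> real grid * u i"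
    using assms by (intro mult_left_mono; simp)+
  then show ?thesis by (simp add: floor_le_iff le_floor_iff)
qed

lemma abs_round_grid_le_1:
  assumes "\<bar>u i\<bar> \<le> 1"
  shows "\<bar>round_grid u i\<bar> \<le> 1"
proof -
  have "\<bar>real_of_int \<lfloor>real grid * u i\<rfloor>\<bar> \<le> real grid"
    using floor_grid_bounds[of u i] assms by auto
  then show ?thesis using grid_pos by (simp add: round_grid_def)
qed

lemma ip_round_grid_close:
  assumes "\<And>i. i < d \<Longrightarrow> \<bar>x i\<bar> \<le> 1"
  shows "\<bar>ip d (round_grid u) x - ip d u x\<bar> \<le> cut_depth / 2"
proof -
  have "ip d (round_grid u) x - ip d u x = (\<Sum>i<d. (round_grid u i - u i) * x i)"
    by (simp add: ip_def left_diff_distrib sum_subtractf)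
  also have "\<bar>\<dots>\<bar> \<le> (\<Sum>i<d. \<bar>round_grid u i - u i\<bar> * \<bar>x i\<bar>)"
    unfolding abs_mult[symmetric] by (rule sum_abs)
  also have "\<dots> \<le> (\<Sum>i<d. 1 / real grid * 1)"
    using assms round_grid_close by (intro sum_mono mult_mono) auto
  also have "\<dots> = 1 / (8 * real d)"
    using d_ge by (simp add: grid_def power2_eq_square)
  finally show ?thesis using inverse_d_le by linarith
qed

lemma fresh_direction_props:
  assumes "p < P" "length E < k"
  shows "\<And>i. i \<notin> blk p \<Longrightarrow> fresh_direction p E x i = 0" "ip d (fresh_direction p E x) (fresh_direction p E x) = 1"
    "ip d (fresh_direction p E x) x = 0" "\<And>u y. (u, y) \<in> set E \<Longrightarrow> ip d (fresh_direction p E x) u = 0"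
    "\<And>u y. (u, y) \<in> set E \<Longrightarrow> ip d (fresh_direction p E x) y = 0"
proof -
  have "length (x # map fst E @ map snd E) < card (blk p)"
    using assms by (simp add: card_blk)
  from unit_vector_orthogonal_to_few[OF blk_subset_d[OF assms(1)] this]
  have "(\<forall>i. i \<notin> blk p \<longrightarrow> fresh_direction p E x i = 0) \<and> ip d (fresh_direction p E x) (fresh_direction p E x) = 1 \<and>
     (\<forall>f\<in>set (x # map fst E @ map snd E). ip d (fresh_direction p E x) f = 0)"
    unfolding fresh_direction_def by (rule someI_ex)
  then show "\<And>i. i \<notin> blk p \<Longrightarrow> fresh_direction p E x i = 0" "ip d (fresh_direction p E x) (fresh_direction p E x) = 1"
    "ip d (fresh_direction p E x) x = 0" "\<And>u y. (u, y) \<in> set E \<Longrightarrow> ip d (fresh_direction p E x) u = 0"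
    "\<And>u y. (u, y) \<in> set E \<Longrightarrow> ip d (fresh_direction p E x) y = 0"
    by (force simp: ball_Un)+
qed

section \<open>The static oracle and its body\<close>

lemma adv_oracle_None_iff:
  "adv_oracle I B V x = None \<longleftrightarrow> enorm d x \<le> 1 \<and> (\<forall>i. \<not> violates I B x i) \<and> (\<forall>v\<in>set V. ip d v x \<le> - cut_depth)"
  unfolding adv_oracle_def by (auto simp: find_None_iff Let_def not_less)

lemma adv_oracle_None_iff_body:
  assumes "x \<in> Rd d"
  shows "adv_oracle {..<n} B V x = None \<longleftrightarrow> x \<in> body B V"
  using assms unfolding adv_oracle_None_iff body_def violates_def by (auto simp: not_less) (meson not_le)

lemma row_in_Rd: "i < n \<Longrightarrow> row i b \<in> Rd d"
  using n_le by (auto simp: Rd_def row_def)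

lemma adv_oracle_append:
  assumes "adv_oracle I B V x \<noteq> None"
  shows "adv_oracle I B (V @ W) x = adv_oracle I B V x"
proof -
  have "List.find p (V @ W) = List.find p V" if "List.find p V \<noteq> None" for p :: "vec \<Rightarrow> bool"
    using that by (induction V) auto
  then show ?thesis using assms unfolding adv_oracle_def by (auto split: if_splits)
qed

text \<open>Each answer is an outer normal of a constraint of \<open>body\<close> that the query
  breaks; outside the unit ball, Cauchy-Schwarz makes the query itself such a normal.\<close>

lemma sep_oracle_adv_oracle:
  assumes "set V \<subseteq> Rd d"
  shows "sep_oracle d (body B V) (adv_oracle {..<n} B V)"
  unfolding sep_oracle_def
proof
  fix x assume x: "x \<in> Rd d"
  consider (norm) "1 < enorm d x" | (row) "enorm d x \<le> 1" "\<exists>i. violates {..<n} B x i"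
    | (old) "enorm d x \<le> 1" "\<nexists>i. violates {..<n} B x i" "\<exists>v\<in>set V. - cut_depth < ip d v x"
    | (ok) "enorm d x \<le> 1" "\<nexists>i. violates {..<n} B x i" "\<forall>v\<in>set V. ip d v x \<le> - cut_depth"
    by fastforce
  then show "(adv_oracle {..<n} B V x = None \<and> x \<in> body B V) \<or>
      (\<exists>g\<in>Rd d. adv_oracle {..<n} B V x = Some g \<and> (\<forall>x'\<in>body B V. ip d g (\<lambda>i. x i - x' i) > 0))"
  proof cases
    case norm
    have "ip d x (\<lambda>i. x i - x' i) > 0" if "x' \<in> body B V" for x'
    proof -
      have "ip d x x' \<le> enorm d x * enorm d x'" using abs_ip_le[of d x x'] by linarith
      also have "\<dots> \<le> enorm d x * 1"
        using that enorm_nonneg by (intro mult_left_mono) (auto simp: body_def)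
      also have "\<dots> < enorm d x * enorm d x" using norm by simp
      finally show ?thesis by (simp add: ip_diff_right ip_self power2_eq_square)
    qed
    then show ?thesis using norm x by (auto simp: adv_oracle_def)
  next
    case row
    define i where "i = (LEAST i. violates {..<n} B x i)"
    have i: "violates {..<n} B x i" unfolding i_def using row(2) by (rule LeastI_ex)
    define a where "a = ip d (row i (B i)) x"
    have "ip d (cut i (B i) x) (\<lambda>j. x j - x' j) > 0" if "x' \<in> body B V" for x'
    proof -
      have "\<bar>ip d (row i (B i)) x'\<bar> \<le> row_tol" "row_tol < \<bar>a\<bar>"
        using that i by (auto simp: body_def violates_def a_def)
      then show ?thesis
        unfolding cut_def ip_cmult_left ip_diff_right a_def[symmetric]
        by (auto simp: sgn_if abs_if split: if_splits)
    qed
    moreover have "cut i (B i) x \<in> Rd d"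
      using row_in_Rd[of i "B i"] i by (auto simp: cut_def Rd_def violates_def)
    ultimately show ?thesis using row by (auto simp: adv_oracle_def Let_def i_def[symmetric])
  next
    case old
    then obtain v where v: "List.find (\<lambda>v. - cut_depth < ip d v x) V = Some v"
      by (metis find_None_iff not_None_eq)
    then have "v \<in> set V" "- cut_depth < ip d v x" by (auto simp: find_Some_iff)
    moreover have "ip d v (\<lambda>i. x i - x' i) > 0" if "x' \<in> body B V" for x'
      using that calculation by (force simp: ip_diff_right body_def)
    ultimately show ?thesis using old(1,2) v assms by (auto simp: adv_oracle_def)
  next
    case ok
    then have "adv_oracle {..<n} B V x = None" by (simp add: adv_oracle_None_iff)
    then show ?thesis using adv_oracle_None_iff_body[OF x] by simp
  qed
qed

lemma convex_body: "convex_d d (body B V)"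
  unfolding convex_d_def
proof (intro conjI ballI allI impI)
  show "body B V \<subseteq> Rd d" by (auto simp: body_def)
next
  fix x y :: vec and t :: real
  assume xy: "x \<in> body B V" "y \<in> body B V" and t: "0 \<le> t \<and> t \<le> 1"
  have le: "(1 - t) * a + t * b \<le> c" if "a \<le> c" "b \<le> c" for a b c :: real
    using that t convex_bound_le[of a c b "1 - t" t] by simp
  have "\<bar>(1 - t) * a + t * b\<bar> \<le> c" if "\<bar>a\<bar> \<le> c" "\<bar>b\<bar> \<le> c" for a b c :: real
    using le[of a c b] le[of "- a" c "- b"] that by (auto simp: abs_le_iff)
  then show "(\<lambda>i. (1 - t) * x i + t * y i) \<in> body B V"
    using xy t le by (auto simp: body_def Rd_def ip_convex_right enorm_le_1_convex)
qed

lemma ip_row: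
  assumes "i < n"
  shows "ip d (row i b) x = (\<Sum>j<n. real (b j) / (real n * real G) * x j) + x (n + i)"
proof -
  have "ip d (row i b) x = (\<Sum>j\<in>{..<n} \<union> {n + i}. row i b j * x j)"
    unfolding ip_def using assms n_le by (intro sum.mono_neutral_right) (auto simp: row_def)
  also have "\<dots> = (\<Sum>j<n. row i b j * x j) + row i b (n + i) * x (n + i)"
    by (subst sum.union_disjoint) auto
  finally show ?thesis by (simp add: row_def)
qed

text \<open>The centre has \<open>y\<close> equal to \<open>- c\<close> times the sum of the
  orthonormal directions, which puts it at depth \<open>c\<close> along each of them, and
  \<open>z\<close> chosen so that every row vanishes exactly.\<close>

lemma body_contains_ball:
  assumes B: "\<And>i j. i < n \<Longrightarrow> j < n \<Longrightarrow> B i j < G"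
    and supp: "\<And>u i. u \<in> set Us \<Longrightarrow> n \<le> i \<Longrightarrow> u i = 0"
    and unit: "\<And>u. u \<in> set Us \<Longrightarrow> ip d u u = 1"
    and orth: "sorted_wrt (\<lambda>u u'. ip d u u' = 0) Us"
    and len: "length Us \<le> n"
  shows "\<exists>xs\<in>Ball_d d (\<lambda>_. 0) 1. Ball_d d xs eps \<subseteq> body B (map round_grid Us)"
proof -
  define N where "N = length Us"
  \<comment> \<open>With at most \<open>d\<close> orthonormal directions this makes the squared norm
    of \<open>y\<close> at most \<open>1 / 4\<close>.\<close>
  define c where "c = 1 / (2 * sqrt (real d))"
  have c: "0 < c" "c = 2 * cut_depth" "c * c * real d = 1 / 4"
    using d_ge by (auto simp: c_def cut_depth_def)
  have onb: "ip d (Us ! l) (Us ! l') = (if l = l' then 1 else 0)" if "l < N" "l' < N" for l l'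
    using orth that unit[of "Us ! l"] unfolding sorted_wrt_iff_nth_less N_def
    by (metis ip_commute linorder_neqE_nat nth_mem)
  define y where "y = (\<lambda>i. - c * (\<Sum>l<N. (Us ! l) i))"
  have y_supp: "y i = 0" if "n \<le> i" for i
    using supp that by (simp add: y_def N_def sum.neutral)
  have ip_y: "ip d w y = - c * (\<Sum>l<N. ip d w (Us ! l))" for w
    unfolding y_def using ip_cmult_left ip_sum_right ip_commute by metis
  have ip_u_y: "ip d (Us ! l) y = - c" if "l < N" for l
  proof -
    have "(\<Sum>l'<N. ip d (Us ! l) (Us ! l')) = (\<Sum>l'<N. if l = l' then 1 else 0)"
      using onb that by (intro sum.cong) auto
    then show ?thesis using that by (simp add: ip_y)
  qed
  have "(\<Sum>l<N. ip d y (Us ! l)) = (\<Sum>l<N. - c)"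
    using ip_u_y by (intro sum.cong) (auto simp: ip_commute[of d y])
  then have "ip d y y = c * c * real N" by (subst ip_y) simp
  also have "\<dots> \<le> c * c * real d"
    using len n_le c(1) by (intro mult_left_mono) (auto simp: N_def)
  finally have yy: "ip d y y \<le> 1 / 4" using c(3) by simp
  have yy_n: "ip d y y = (\<Sum>j<n. (y j)\<^sup>2)"
    using n_le y_supp by (subst ip_supported[of "{..<n}"]) (auto simp: power2_eq_square)
  define z where "z = (\<lambda>i. - (\<Sum>j<n. real (B i j) / (real n * real G) * y j))"
  \<comment> \<open>Cauchy-Schwarz with a row of norm at most \<open>1 / sqrt n\<close>: all of
    \<open>z\<close> together is no longer than \<open>1 / 2\<close>.\<close>
  have z2: "(z i)\<^sup>2 \<le> 1 / (4 * real n)" if i: "i < n" for i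
  proof -
    have "\<bar>z i\<bar> \<le> (\<Sum>j<n. \<bar>real (B i j) / (real n * real G)\<bar> * \<bar>y j\<bar>)"
      unfolding z_def abs_minus_cancel abs_mult[symmetric] by (rule sum_abs)
    also have "\<dots> \<le> L2_set (\<lambda>j. real (B i j) / (real n * real G)) {..<n} * L2_set y {..<n}"
      by (rule L2_set_mult_ineq)
    also have "L2_set (\<lambda>j. real (B i j) / (real n * real G)) {..<n} \<le> L2_set (\<lambda>j. 1 / real n) {..<n}"
    proof (rule L2_set_mono)
      fix j assume "j \<in> {..<n}"
      then have "real (B i j) \<le> real G" using B[OF i, of j] by simp
      then show "real (B i j) / (real n * real G) \<le> 1 / real n"
        using n_pos G_pos by (simp add: field_simps)
    qed auto
    finally have "\<bar>z i\<bar> \<le> sqrt (real n) * (1 / real n) * L2_set y {..<n}"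
      by (simp add: L2_set_constant mult_right_mono)
    then have "\<bar>z i\<bar>\<^sup>2 \<le> (sqrt (real n) * (1 / real n) * L2_set y {..<n})\<^sup>2"
      by (intro power_mono) auto
    also have "\<dots> = 1 / real n * ip d y y"
      using n_pos unfolding yy_n L2_set_def
      by (simp add: power_mult_distrib sum_nonneg power_divide) (simp add: power2_eq_square)
    also have "\<dots> \<le> 1 / real n * (1 / 4)"
      using yy by (intro mult_left_mono) auto
    finally show ?thesis by (simp add: mult.commute)
  qed
  define xs where "xs = (\<lambda>i. if i < n then y i else if i < 2 * n then z (i - n) else 0)"
  have "(\<Sum>i<d. (xs i)\<^sup>2) = (\<Sum>i<2 * n. (xs i)\<^sup>2)"
    using n_le by (intro sum.mono_neutral_right) (auto simp: xs_def)
  also have "\<dots> = (\<Sum>i<n. (xs i)\<^sup>2) + (\<Sum>i<n. (xs (n + i))\<^sup>2)"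
    by (simp add: mult_2 sum_lessThan_add)
  also have "\<dots> = ip d y y + (\<Sum>i<n. (z i)\<^sup>2)"
    by (simp add: xs_def yy_n)
  also have "\<dots> \<le> 1 / 4 + (\<Sum>i<n. 1 / (4 * real n))"
    using yy z2 by (intro add_mono sum_mono) auto
  \<comment> \<open>The squared norm is at most \<open>1 / 2\<close>, below \<open>9 / 16\<close>;
    the remaining distance \<open>1 / 4\<close> to the unit sphere exceeds
    \<open>eps\<close>.\<close>
  also have "\<dots> \<le> (3 / 4)\<^sup>2"
    using n_pos by (simp add: power2_eq_square)
  finally have xs_norm: "enorm d xs \<le> 3 / 4"
    unfolding enorm_def by (intro real_le_lsqrt) (simp_all add: sum_nonneg)
  have xs_Rd: "xs \<in> Rd d" using n_le by (auto simp: Rd_def xs_def)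
  have ip_u_xs: "ip d (Us ! l) xs = - c" if "l < N" for l
  proof -
    have "Us ! l \<in> set Us" using that by (simp add: N_def)
    then have "(Us ! l) i * xs i = (Us ! l) i * y i" for i
      using supp[of "Us ! l" i] by (cases "i < n") (auto simp: xs_def)
    then have "ip d (Us ! l) xs = ip d (Us ! l) y" unfolding ip_def by (intro sum.cong refl)
    then show ?thesis using ip_u_y[OF that] by simp
  qed
  have ip_row_xs: "ip d (row i (B i)) xs = 0" if "i < n" for i
    using that by (simp add: ip_row xs_def z_def)
  have "Ball_d d xs eps \<subseteq> body B (map round_grid Us)"
  proof
    fix x assume "x \<in> Ball_d d xs eps"
    then have x: "x \<in> Rd d" "enorm d (\<lambda>i. xs i - x i) \<le> eps" by (auto simp: Ball_d_def)
    define w where "w = (\<lambda>i. xs i - x i)"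
    have w: "\<bar>w i\<bar> \<le> eps" if "i < d" for i
      using abs_coord_le_enorm[OF that, of w] x(2) unfolding w_def by linarith
    have ip_x: "ip d g x = ip d g xs - ip d g w" for g
      by (simp add: w_def ip_diff_right)
    have "enorm d x = enorm d (\<lambda>i. xs i + (-1) * w i)"
      by (simp add: w_def)
    also have "\<dots> \<le> enorm d xs + enorm d w"
      using enorm_triangle[of d xs "\<lambda>i. (-1) * w i"] enorm_cmult[of d "-1" w] by simp
    finally have "enorm d x \<le> 1"
      using xs_norm x(2) eps_le by (simp add: w_def)
    moreover have "\<bar>ip d (row i (B i)) x\<bar> \<le> row_tol" if i: "i < n" for i
    proof -
      have "\<bar>\<Sum>j<n. real (B i j) / (real n * real G) * w j\<bar>
          \<le> (\<Sum>j<n. \<bar>real (B i j) / (real n * real G)\<bar> * \<bar>w j\<bar>)"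
        unfolding abs_mult[symmetric] by (rule sum_abs)
      also have "\<dots> \<le> (\<Sum>j<n. 1 / real n * eps)"
      proof (intro sum_mono mult_mono)
        fix j assume "j \<in> {..<n}"
        then have "real (B i j) \<le> real G" "j < d" using B[OF i, of j] n_le by auto
        then show "\<bar>real (B i j) / (real n * real G)\<bar> \<le> 1 / real n" "\<bar>w j\<bar> \<le> eps"
          using n_pos G_pos w by (auto simp: field_simps)
      qed auto
      also have "\<dots> = eps" using n_pos by simp
      finally have "\<bar>ip d (row i (B i)) w\<bar> \<le> eps + eps"
        unfolding ip_row[OF i] using w[of "n + i"] i n_le by linarith
      then show ?thesis
        using i by (simp add: ip_x ip_row_xs row_tol_def)
    qed
    moreover have "ip d (round_grid u) x \<le> - cut_depth" if u: "u \<in> set Us" for u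
    proof -
      obtain l where l: "l < N" "u = Us ! l" using u by (auto simp: in_set_conv_nth N_def)
      have "\<bar>xs i\<bar> \<le> 1" if "i < d" for i
        using abs_coord_le_enorm[OF that, of xs] xs_norm by linarith
      from ip_round_grid_close[of xs u, OF this] have "ip d (round_grid u) xs \<le> - c + cut_depth / 2"
        using ip_u_xs[OF l(1)] unfolding l(2) by linarith
      moreover have "\<bar>ip d (round_grid u) w\<bar> \<le> cut_depth / 2"
      proof -
        have "\<bar>ip d (round_grid u) w\<bar> \<le> (\<Sum>i<d. \<bar>round_grid u i\<bar> * \<bar>w i\<bar>)"
          unfolding ip_def abs_mult[symmetric] by (rule sum_abs)
        also have "\<dots> \<le> (\<Sum>i<d. 1 * eps)"
          using w abs_round_grid_le_1 abs_coord_le_1_of_unit[OF unit[OF u]]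
          by (intro sum_mono mult_mono) auto
        finally show ?thesis using d_eps_le by simp
      qed
      ultimately show ?thesis using c(2) by (simp add: ip_x)
    qed
    ultimately show "x \<in> body B (map round_grid Us)" using x(1) by (auto simp: body_def)
  qed
  moreover have "xs \<in> Ball_d d (\<lambda>_. 0) 1"
    using xs_Rd xs_norm enorm_cmult[of d "-1" xs] by (simp add: Ball_d_def)
  ultimately show ?thesis by blast
qed

section \<open>The invariant of the adaptive run\<close>

text \<open>The inner products of directions with queries form a triangular system: zero when the
  direction is not older than the query, at most \<open>- cut_depth / 2\<close> when it is older.
  The unrounded directions are kept because only they are exactly orthogonal.\<close>

definition explored :: "nat \<Rightarrow> (nat \<Rightarrow> nat \<Rightarrow> nat) \<Rightarrow> (vec \<times> vec) list \<Rightarrow> bool" where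
  "explored p B E \<longleftrightarrow>
    (\<forall>(u, x)\<in>set E. (\<forall>i. i \<notin> blk p \<longrightarrow> u i = 0) \<and> ip d u u = 1 \<and> ip d u x = 0 \<and> enorm d x \<le> 1 \<and>
       (\<forall>i<n. \<bar>ip d (row i (B i)) x\<bar> \<le> row_tol)) \<and>
    sorted_wrt (\<lambda>(u, x) (u', x'). ip d u x' \<le> - cut_depth / 2 \<and> ip d u' x = 0) E"

definition orthosys :: "vec list \<Rightarrow> bool" where
  "orthosys Us \<longleftrightarrow> (\<forall>u\<in>set Us. ip d u u = 1) \<and> sorted_wrt (\<lambda>u u'. ip d u u' = 0) Us"

text \<open>The last clause makes the next direction orthogonal to all previous ones: those of
  finished periods have disjoint support, those of the current period are listed in
  \<open>E\<close>.\<close>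

definition adv_inv :: "(nat \<Rightarrow> nat \<Rightarrow> nat) \<Rightarrow> bool list \<times> vec list \<times> (vec \<times> vec) list \<Rightarrow> bool" where
  "adv_inv B = (\<lambda>(s, V, E). length s = M \<and> length E = length V mod k \<and> length V \<le> k * P \<and>
     explored (length V div k) B E \<and>
     (\<forall>(u, x)\<in>set E. round_grid u \<in> set V) \<and>
     (\<exists>Us. V = map round_grid Us \<and> orthosys Us \<and>
        (\<forall>u\<in>set Us. (\<exists>p<length V div k. p < P \<and> (\<forall>i. i \<notin> blk p \<longrightarrow> u i = 0)) \<or> u \<in> fst ` set E)))"

lemma adv_inv_init: "adv_inv B init"
  by (auto simp: adv_inv_def init_def explored_def orthosys_def)

lemma adv_inv_adv_step:
  assumes "adv_inv B (s, V, E)" "length (fst (snd (adv_step {..<n} B (s, V, E)))) \<le> k * P"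
  shows "adv_inv B (adv_step {..<n} B (s, V, E))"
proof (cases "adv_oracle {..<n} B V (qry s)")
  case (Some r)
  then show ?thesis
    using assms(1) alg by (auto simp: adv_step_def adv_inv_def mem_alg_def)
next
  case None
  define q where "q = qry s"
  define p where "p = length V div k"
  define u where "u = fresh_direction p E q"
  have adv_step: "adv_step {..<n} B (s, V, E)
      = (upd s q (Some (round_grid u)), V @ [round_grid u], if Suc (length E) = k then [] else E @ [(u, q)])"
    using None by (simp add: adv_step_def q_def u_def p_def Let_def)
  have len_s: "length s = M" and len_E: "length E = length V mod k"
    and expl: "explored p B E" and E_V: "\<And>u x. (u, x) \<in> set E \<Longrightarrow> round_grid u \<in> set V"
    using assms(1) by (auto simp: adv_inv_def p_def)
  obtain Us where Us: "V = map round_grid Us" "orthosys Us"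
    "\<And>u. u \<in> set Us \<Longrightarrow> (\<exists>p'<p. p' < P \<and> (\<forall>i. i \<notin> blk p' \<longrightarrow> u i = 0)) \<or> u \<in> fst ` set E"
    using assms(1) by (auto simp: adv_inv_def p_def)
  \<comment> \<open>An exploratory step adds a cut, so there was room for one more, and the current
    period has a block of its own.\<close>
  have "length V < k * P" using assms(2) adv_step by simp
  then have p: "p < P" by (simp add: p_def less_mult_imp_div_less mult.commute)
  have len_lt: "length E < k" using len_E k_pos by simp
  note u = fresh_direction_props[OF p len_lt, where x = q, folded u_def]
  have q: "enorm d q \<le> 1" "\<And>i. i < n \<Longrightarrow> \<bar>ip d (row i (B i)) q\<bar> \<le> row_tol"
    "\<And>v. v \<in> set V \<Longrightarrow> ip d v q \<le> - cut_depth"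
    using None[folded q_def] by (auto simp: adv_oracle_None_iff violates_def not_less) (meson not_le)
  have q1: "\<bar>q i\<bar> \<le> 1" if "i < d" for i
    using abs_coord_le_enorm[OF that, of q] q(1) by linarith
  \<comment> \<open>The query respects the rounded cut to depth \<open>cut_depth\<close>; passing
    back to the unrounded direction costs at most half of that.\<close>
  have old: "ip d u' q \<le> - cut_depth / 2" if "(u', x) \<in> set E" for u' x
    using q(3)[OF E_V[OF that]] ip_round_grid_close[of q u', OF q1] by linarith
  have expl': "explored p B (E @ [(u, q)])"
    using expl u q old unfolding explored_def by (auto simp: sorted_wrt_append)
  have orth: "orthosys (Us @ [u])"
  proof -
    have "ip d u' u = 0" if u': "u' \<in> set Us" for u'
      using Us(3)[OF u']
    proof
      assume "\<exists>p'<p. p' < P \<and> (\<forall>i. i \<notin> blk p' \<longrightarrow> u' i = 0)"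
      then obtain p' where p': "p' < p" "\<And>i. i \<notin> blk p' \<Longrightarrow> u' i = 0" by auto
      have "u' i * u i = 0" for i
        using p'(2)[of i] u(1)[of i] blk_disjoint[OF p'(1)] by fastforce
      then show ?thesis unfolding ip_def by (intro sum.neutral) blast
    next
      assume "u' \<in> fst ` set E"
      then show ?thesis using u(4) by (auto simp: ip_commute)
    qed
    then show ?thesis using Us(2) u(2) by (auto simp: orthosys_def sorted_wrt_append)
  qed
  have len_upd: "length (upd s q (Some (round_grid u))) = M" using alg len_s by (simp add: mem_alg_def)
  show ?thesis
  proof (cases "Suc (length E) = k")
    case True
    then have modk: "Suc (length V) mod k = 0" using len_E by (simp add: mod_Suc)
    have divk: "Suc (length V) div k = Suc p"
      using True len_E by (simp add: div_Suc modk p_def mod_Suc)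
    \<comment> \<open>The period is complete: its directions leave \<open>E\<close> and from now on
      count as supported in the block of a finished period.\<close>
    have "\<exists>p'<Suc p. p' < P \<and> (\<forall>i. i \<notin> blk p' \<longrightarrow> u' i = 0)" if "u' \<in> set (Us @ [u])" for u'
    proof -
      have "(\<forall>i. i \<notin> blk p \<longrightarrow> u' i = 0)" if "u' \<in> fst ` set E \<or> u' = u"
        using that u(1) expl by (auto simp: explored_def)
      then show ?thesis using that Us(3)[of u'] p by (auto intro: less_SucI)
    qed
    then show ?thesis
      unfolding adv_step adv_inv_def using True modk divk len_upd orth Us(1) assms(2) adv_step
      by (auto simp: explored_def intro!: exI[of _ "Us @ [u]"])
  next
    case False
    then have modk: "Suc (length V) mod k = Suc (length E)" using len_E by (simp add: mod_Suc)
    have divk: "Suc (length V) div k = p"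
      using modk by (simp add: div_Suc p_def)
    have "(\<exists>p'<p. p' < P \<and> (\<forall>i. i \<notin> blk p' \<longrightarrow> u' i = 0)) \<or> u' \<in> fst ` set (E @ [(u, q)])"
      if "u' \<in> set (Us @ [u])" for u'
      using that Us(3)[of u'] by auto
    then have "\<exists>Us'. V @ [round_grid u] = map round_grid Us' \<and> orthosys Us' \<and> (\<forall>u'\<in>set Us'.
        (\<exists>p'<p. p' < P \<and> (\<forall>i. i \<notin> blk p' \<longrightarrow> u' i = 0)) \<or> u' \<in> fst ` set (E @ [(u, q)]))"
      using orth Us(1) by (intro exI[of _ "Us @ [u]"]) simp
    then show ?thesis
      unfolding adv_step adv_inv_def using False modk divk len_upd expl' E_V assms(2) adv_step by auto
  qed
qed

section \<open>Counting exploratory queries along a run\<close>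

lemma length_adv_step:
  "length (fst (snd (adv_step I B (s, V, E)))) = (if adv_oracle I B V (qry s) = None then Suc (length V) else length V)"
  by (auto simp: adv_step_def Let_def split: option.split)

text \<open>Every exploratory query adds exactly one cut, so the number of cuts counts these
  queries.\<close>

definition exploratory_count where "exploratory_count B t = length (fst (snd (run {..<n} B init t)))"

lemma exploratory_count_Suc: "exploratory_count B (Suc t) = exploratory_count B t \<or> exploratory_count B (Suc t) = Suc (exploratory_count B t)"
proof -
  obtain s V E where st: "run {..<n} B init t = (s, V, E)" by (cases "run {..<n} B init t")
  show ?thesis unfolding exploratory_count_def run_Suc st length_adv_step by simp
qed

lemma exploratory_count_mono: "t \<le> t' \<Longrightarrow> exploratory_count B t \<le> exploratory_count B t'"
  by (rule lift_Suc_mono_le[of "exploratory_count B"]) (use exploratory_count_Suc[of B] in \<open>metis le_SucI order_refl\<close>)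

lemma exploratory_count_le: "exploratory_count B t \<le> t"
proof (induction t)
  case (Suc t)
  then show ?case using exploratory_count_Suc[of B t] by linarith
qed (simp add: exploratory_count_def init_def)

lemma adv_inv_run: "exploratory_count B t \<le> k * P \<Longrightarrow> adv_inv B (run {..<n} B init t)"
proof (induction t)
  case 0
  then show ?case by (simp add: adv_inv_init)
next
  case (Suc t)
  obtain s V E where st: "run {..<n} B init t = (s, V, E)" by (cases "run {..<n} B init t")
  have "adv_inv B (s, V, E)" using Suc exploratory_count_mono[of t "Suc t" B] st by simp
  then show ?case using adv_inv_adv_step[of B s V E] Suc.prems by (simp add: exploratory_count_def run_Suc st)
qed

text \<open>Freeze the list \<open>V\<close> reached after \<open>T\<close> steps. The static oracle
  for \<open>V\<close> repeats every answer of the adaptive run, and all those answers are vectors,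
  so none of the first \<open>T\<close> queries lies in the body.\<close>

lemma resisting_instance_exists:
  assumes B: "\<And>i j. i < n \<Longrightarrow> j < n \<Longrightarrow> B i j < G" and T: "exploratory_count B T \<le> k * P"
  shows "\<exists>Q Orc. feas_instance d eps Q Orc \<and> (\<forall>t<T. query_at M qry upd Orc t \<notin> Q)"
proof -
  obtain s V E where st: "run {..<n} B init T = (s, V, E)" by (cases "run {..<n} B init T")
  define Q Orc where "Q = body B V" and "Orc = adv_oracle {..<n} B V"
  have "adv_inv B (s, V, E)" using adv_inv_run[OF T] st by simp
  then obtain Us where expl: "explored (length V div k) B E" and
    Us: "V = map round_grid Us" "orthosys Us" and VP: "length V \<le> k * P" "length E = length V mod k"
    and supp: "\<And>u. u \<in> set Us \<Longrightarrow>
      (\<exists>p<length V div k. p < P \<and> (\<forall>i. i \<notin> blk p \<longrightarrow> u i = 0)) \<or> u \<in> fst ` set E"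
    by (auto simp: adv_inv_def)
  have supp_n: "u i = 0" if u: "u \<in> set Us" and i: "n \<le> i" for u i
    using supp[OF u]
  proof
    assume "\<exists>p<length V div k. p < P \<and> (\<forall>i. i \<notin> blk p \<longrightarrow> u i = 0)"
    then show ?thesis using blk_subset i by (meson lessThan_iff not_le subsetD)
  next
    assume u: "u \<in> fst ` set E"
    \<comment> \<open>A nonempty \<open>E\<close> means that \<open>k\<close> does not divide
      \<open>length V\<close>; hence the current period is one of the \<open>P\<close> periods with
      a block inside the first \<open>n\<close> coordinates.\<close>
    then have "length V \<noteq> k * P" using VP(2) by auto
    then have "length V div k < P"
      using VP(1) by (intro less_mult_imp_div_less) (simp add: mult.commute)
    moreover have "\<forall>i. i \<notin> blk (length V div k) \<longrightarrow> u i = 0"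
      using u expl by (auto simp: explored_def)
    ultimately show ?thesis using blk_subset i by (meson lessThan_iff not_le subsetD)
  qed
  have "length Us \<le> n"
  proof -
    have "length V \<le> 2 * k * P" using VP(1) by simp
    then show ?thesis using kP_le Us(1) by simp
  qed
  then have ball: "\<exists>xs\<in>Ball_d d (\<lambda>_. 0) 1. Ball_d d xs eps \<subseteq> Q"
    unfolding Q_def Us(1) using Us(2) B supp_n by (intro body_contains_ball) (auto simp: orthosys_def)
  have "set V \<subseteq> Rd d"
    using supp_n n_le by (auto simp: Us(1) Rd_def intro!: round_grid_zero)
  then have sep: "sep_oracle d Q Orc" unfolding Q_def Orc_def by (rule sep_oracle_adv_oracle)
  have sub: "Q \<subseteq> Ball_d d (\<lambda>_. 0) 1"
  proof
    fix x assume "x \<in> Q"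
    then show "x \<in> Ball_d d (\<lambda>_. 0) 1"
      using enorm_cmult[of d "-1" x] by (simp add: Q_def body_def Ball_d_def)
  qed
  have feas: "feas_instance d eps Q Orc"
    using ball sep sub convex_body by (simp add: feas_instance_def Q_def)
  have prefix: "\<exists>W. V = fst (snd (run {..<n} B init t)) @ W" if "t \<le> T" for t
    using that
  proof (induction rule: inc_induct)
    case base
    then show ?case by (simp add: st)
  next
    case (step t)
    obtain s' V' E' where st': "run {..<n} B init t = (s', V', E')" by (cases "run {..<n} B init t")
    have "\<exists>W. fst (snd (run {..<n} B init (Suc t))) = V' @ W"
      by (auto simp: run_Suc st' adv_step_def Let_def split: option.split)
    then show ?case using step.IH by (auto simp: st')
  qed
  have resp: "\<exists>r. Orc (qry (fst (run {..<n} B init t))) = Some r \<and>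
      fst (run {..<n} B init (Suc t)) = upd (fst (run {..<n} B init t)) (qry (fst (run {..<n} B init t))) (Some r)"
    if t: "t < T" for t
  proof -
    obtain s' V' E' where st': "run {..<n} B init t = (s', V', E')" by (cases "run {..<n} B init t")
    define q where "q = qry s'"
    show ?thesis
    proof (cases "adv_oracle {..<n} B V' q")
      case (Some r)
      obtain W where "V = V' @ W" using prefix[of t] t st' by auto
      then have "Orc q = Some r" using adv_oracle_append[of "{..<n}" B V' q W] Some by (simp add: Orc_def)
      then show ?thesis using Some by (auto simp: run_Suc st' adv_step_def q_def Let_def)
    next
      case None
      define u where "u = fresh_direction (length V' div k) E' q"
      have st'': "fst (run {..<n} B init (Suc t)) = upd s' q (Some (round_grid u))"
        "fst (snd (run {..<n} B init (Suc t))) = V' @ [round_grid u]"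
        using None by (auto simp: run_Suc st' adv_step_def q_def u_def Let_def)
      obtain W where W: "V = (V' @ [round_grid u]) @ W" using prefix[of "Suc t"] t st''(2) by auto
      have "exploratory_count B t \<le> k * P" using exploratory_count_mono[of t T B] T t by simp
      then have "adv_inv B (s', V', E')" using adv_inv_run[of B t] st' by simp
      then have "length E' < k" using k_pos by (simp add: adv_inv_def)
      moreover have "length V' < k * P" using W VP(1) by simp
      then have "length V' div k < P" by (simp add: less_mult_imp_div_less mult.commute)
      ultimately have "ip d u q = 0" unfolding u_def by (intro fresh_direction_props(3))
      moreover have q: "enorm d q \<le> 1" "\<forall>i. \<not> violates {..<n} B q i" "\<forall>v\<in>set V'. ip d v q \<le> - cut_depth"
        using None by (auto simp: adv_oracle_None_iff)
      have "\<bar>q i\<bar> \<le> 1" if "i < d" for i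
        using abs_coord_le_enorm[OF that, of q] q(1) by linarith
      \<comment> \<open>The direction is orthogonal to the query, so the rounded product is at least
        \<open>- cut_depth / 2\<close>: the query violates its own new cut, and that cut is the
        first one it violates.\<close>
      ultimately have "- cut_depth < ip d (round_grid u) q"
        using ip_round_grid_close[of q u] cut_depth_pos by simp
      moreover have "List.find p (V' @ [round_grid u]) = (if p (round_grid u) then Some (round_grid u) else None)"
        if "\<forall>v\<in>set V'. \<not> p v" for p
        using that by (induction V') auto
      ultimately have "adv_oracle {..<n} B (V' @ [round_grid u]) q = Some (round_grid u)"
        using q by (auto simp: adv_oracle_def not_less)
      then have "Orc q = Some (round_grid u)"
        using adv_oracle_append[of "{..<n}" B "V' @ [round_grid u]" q W] W by (simp add: Orc_def)
      then show ?thesis using st''(1) by (simp add: st' q_def)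
    qed
  qed
  have mem: "mem_state M qry upd Orc t = fst (run {..<n} B init t)" if "t \<le> T" for t
    using that
  proof (induction t)
    case 0
    then show ?case by (simp add: init_def)
  next
    case (Suc t)
    then show ?case using resp[of t] by (auto simp: Let_def)
  qed
  have "query_at M qry upd Orc t \<notin> Q" if t: "t < T" for t
  proof -
    have "exploratory_count B t \<le> k * P" using exploratory_count_mono[of t T B] T t by simp
    then have "length (fst (run {..<n} B init t)) = M"
      using adv_inv_run[of B t] by (cases "run {..<n} B init t") (auto simp: adv_inv_def)
    then have "qry (fst (run {..<n} B init t)) \<in> Rd d" using alg by (simp add: mem_alg_def)
    then show ?thesis
      using adv_oracle_None_iff_body[of _ B V] resp[OF t] mem[of t] t
      by (fastforce simp: query_at_def Q_def Orc_def)
  qed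
  with feas show ?thesis by blast
qed

subsection \<open>Counting rows compatible with the exploratory queries of a period\<close>

definition rows :: "(nat \<Rightarrow> nat) set" where "rows = {..<n} \<rightarrow>\<^sub>E {..<G}"

lemma card_rows: "card rows = G ^ n" and finite_rows: "finite rows"
  by (simp_all add: rows_def card_PiE finite_PiE)

lemma ip_row_diff:
  assumes "i < n"
  shows "ip d (row i b) x - ip d (row i b') x
    = (\<Sum>j<n. (real (b j) - real (b' j)) * x j) / (real n * real G)"
  unfolding ip_row[OF assms] by (simp add: sum_subtractf[symmetric] sum_divide_distrib left_diff_distrib diff_divide_distrib)

text \<open>The translates of a slab by the rounded vectors $\lambda \sum_{l \in S} u_l$ are pairwise
  disjoint: at the first index $l$ where two sets $S$ differ, the query $x_{l+1}$ sees the
  difference, because $x_{l+1}$ is orthogonal to all later $u$'s.\<close>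

lemma card_slab_packing:
  assumes E: "explored p B E" and p: "p < P" and i: "i < n"
    and lam: "2 * row_tol * (real n * real G) + 2 * real k < lam * (cut_depth / 2)"
    and R: "lam * real (length E) \<le> real R"
  shows "card {b \<in> rows. \<forall>(u, x)\<in>set E. \<bar>ip d (row i b) x\<bar> \<le> row_tol} * 2 ^ (length E - 1)
    \<le> (G + 2 * R) ^ (2 * k) * G ^ (n - 2 * k)"
proof -
  define Z where "Z = {b \<in> rows. \<forall>(u, x)\<in>set E. \<bar>ip d (row i b) x\<bar> \<le> row_tol}"
  define r where "r = length E"
  define u where "u l = fst (E ! l)" for l
  define x where "x l = snd (E ! l)" for l
  have E_nth: "(u l, x l) \<in> set E" if "l < r" for l
    using that by (simp add: u_def x_def r_def)
  have usupp: "u l j = 0" if "l < r" "j \<notin> blk p" for l j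
    using E E_nth that unfolding explored_def by blast
  have uunit: "ip d (u l) (u l) = 1" if "l < r" for l
    using E E_nth that unfolding explored_def by blast
  have ux: "ip d (u l) (x l) = 0" and xnorm: "enorm d (x l) \<le> 1" if "l < r" for l
    using E E_nth that unfolding explored_def by blast+
  have tri: "ip d (u l) (x l') \<le> - cut_depth / 2" "ip d (u l') (x l) = 0" if "l < l'" "l' < r" for l l'
    using E that unfolding explored_def sorted_wrt_iff_nth_less u_def x_def r_def
    by (auto simp: case_prod_beta)
  have lam_pos: "0 < lam"
  proof -
    have "0 \<le> 2 * row_tol * (real n * real G) + 2 * real k" using row_tol_pos by simp
    then have "0 < lam * (cut_depth / 2)" using lam by linarith
    then show ?thesis using cut_depth_pos by (simp add: zero_less_mult_iff)
  qed
  define t where "t S j = lam * (\<Sum>l\<in>S. u l j)" for S j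
  define sh where "sh S j = (if j \<in> blk p then \<lfloor>t S j\<rfloor> else 0)" for S j
  \<comment> \<open>Two index sets that first differ at \<open>l\<close> are told apart by the query
    \<open>l + 1\<close>; sets inside \<open>{..<r - 1}\<close> guarantee that this query
    exists.\<close>
  define Phi where "Phi = (\<lambda>(b :: nat \<Rightarrow> nat, S). \<lambda>j\<in>{..<n}. int (b j) + sh S j)"
  \<comment> \<open>A rounded translate leaves the cube by at most \<open>R\<close> on each side,
    and only in the \<open>2 * k\<close> coordinates of the block.\<close>
  define Tgt where "Tgt = (\<Pi>\<^sub>E j\<in>{..<n}. if j \<in> blk p then {- int R..<int G + int R} else {0..<int G})"
  have blk_n: "blk p \<subseteq> {..<n}" and blk_d: "blk p \<subseteq> {..<d}"
    using blk_subset[OF p] blk_subset_d[OF p] by auto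
  have sh_bound: "\<lfloor>t S j\<rfloor> \<in> {- int R..int R}" if S: "S \<subseteq> {..<r - 1}" and j: "j \<in> blk p" for S j
  proof -
    have "\<bar>\<Sum>l\<in>S. u l j\<bar> \<le> (\<Sum>l\<in>S. \<bar>u l j\<bar>)" by (rule sum_abs)
    also have "\<dots> \<le> (\<Sum>l\<in>S. 1)"
      using S j blk_d uunit by (intro sum_mono abs_coord_le_1_of_unit[of d]) auto
    also have "\<dots> \<le> real r"
      using card_mono[OF _ S] by simp
    finally have "lam * \<bar>\<Sum>l\<in>S. u l j\<bar> \<le> lam * real r"
      using lam_pos by (intro mult_left_mono) auto
    also have "\<dots> \<le> real R" using R by (simp add: r_def)
    finally have "\<bar>t S j\<bar> \<le> real R"
      using lam_pos by (simp add: t_def abs_mult)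
    then show ?thesis by (simp add: le_floor_iff floor_le_iff abs_le_iff)
  qed
  have maps: "Phi ` (Z \<times> Pow {..<r - 1}) \<subseteq> Tgt"
  proof
    fix f assume "f \<in> Phi ` (Z \<times> Pow {..<r - 1})"
    then obtain b S where b: "b \<in> Z" and S: "S \<subseteq> {..<r - 1}" and f: "f = Phi (b, S)" by auto
    have "b j < G" if "j < n" for j using b that by (auto simp: Z_def rows_def)
    then have "int (b j) + sh S j \<in> (if j \<in> blk p then {- int R..<int G + int R} else {0..<int G})"
      if "j < n" for j
      using sh_bound[OF S, of j] that by (force simp: sh_def)
    then show "f \<in> Tgt"
      unfolding f Phi_def Tgt_def by simp
  qed
  have inj: "inj_on Phi (Z \<times> Pow {..<r - 1})"
  proof (rule inj_onI, clarify)
    fix b S b' S'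
    assume b: "b \<in> Z" "b' \<in> Z" and S: "S \<subseteq> {..<r - 1}" "S' \<subseteq> {..<r - 1}"
      and eq: "Phi (b, S) = Phi (b', S')"
    have eq_j: "int (b j) + sh S j = int (b' j) + sh S' j" if "j < n" for j
      using fun_cong[OF eq, of j] that by (simp add: Phi_def)
    have fin: "finite S" "finite S'" using S finite_subset by blast+
    have "S = S'"
    proof (rule ccontr)
      assume "S \<noteq> S'"
      define D where "D = (S - S') \<union> (S' - S)"
      define l where "l = Min D"
      have D: "finite D" "D \<noteq> {}" using fin \<open>S \<noteq> S'\<close> by (auto simp: D_def)
      have l: "l \<in> D" "\<And>l'. l' \<in> D \<Longrightarrow> l \<le> l'" unfolding l_def using D by auto
      have lr: "Suc l < r" using l(1) S by (auto simp: D_def)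
      define y where "y = x (Suc l)"
      define a where "a l' = ip d (u l') y" for l'
      have a0: "a l' = 0" if "l < l'" "l' < r" for l'
        using tri(2)[of "Suc l" l'] ux[of "Suc l"] that unfolding a_def y_def
        by (cases "l' = Suc l") auto
      have al: "cut_depth / 2 \<le> \<bar>a l\<bar>" using tri(1)[of l "Suc l"] lr unfolding a_def y_def by linarith
      \<comment> \<open>Indices below \<open>l\<close> lie in both sets or in neither and cancel;
        those above \<open>l\<close> have \<open>a\<close> equal to zero.\<close>
      have sum_a: "\<bar>sum a S - sum a S'\<bar> = \<bar>a l\<bar>"
      proof -
        have "sum a S - sum a S' = sum a (S - S') - sum a (S' - S)"
          using fin by (simp add: sum.Int_Diff[of S a S'] sum.Int_Diff[of S' a S] Int_commute)
        moreover have "sum a A = (if l \<in> A then a l else 0)" if A: "A \<subseteq> D" for A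
        proof -
          have "a l' = 0" if "l' \<in> A - {l}" for l'
          proof -
            have "l' \<in> D" "l' \<noteq> l" using A that by auto
            then have "l < l'" "l' < r" using l(2)[of l'] S by (auto simp: D_def)
            then show ?thesis by (rule a0)
          qed
          moreover have "finite A" using A D(1) finite_subset by blast
          ultimately show ?thesis
            using sum.mono_neutral_right[of A "A \<inter> {l}" a] by auto
        qed
        ultimately show ?thesis using l(1) by (auto simp: D_def)
      qed
      have t_ip: "(\<Sum>j\<in>blk p. t A j * y j) = lam * sum a A" if A: "A \<subseteq> {..<r - 1}" for A
      proof -
        have "(\<Sum>j\<in>blk p. t A j * y j) = lam * (\<Sum>j\<in>blk p. \<Sum>l\<in>A. u l j * y j)"
          by (simp add: t_def sum_distrib_left sum_distrib_right mult.assoc)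
        also have "(\<Sum>j\<in>blk p. \<Sum>l\<in>A. u l j * y j) = (\<Sum>l\<in>A. \<Sum>j\<in>blk p. u l j * y j)"
          by (rule sum.swap)
        also have "\<dots> = sum a A"
          unfolding a_def using A usupp blk_d by (intro sum.cong ip_supported[symmetric]) auto
        finally show ?thesis .
      qed
      have y1: "\<bar>y j\<bar> \<le> 1" if "j \<in> blk p" for j
        using abs_coord_le_enorm[of j d y] xnorm[of "Suc l"] lr blk_d that unfolding y_def by fastforce
      have "(\<Sum>j<n. (real (b j) - real (b' j)) * y j) = (\<Sum>j\<in>blk p. (real (b j) - real (b' j)) * y j)"
      proof (rule sum.mono_neutral_right)
        show "\<forall>j\<in>{..<n} - blk p. (real (b j) - real (b' j)) * y j = 0"
          using eq_j by (fastforce simp: sh_def)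
      qed (use blk_n in auto)
      also have "\<dots> = (\<Sum>j\<in>blk p. (real_of_int \<lfloor>t S' j\<rfloor> - real_of_int \<lfloor>t S j\<rfloor>) * y j)"
      proof (rule sum.cong[OF refl])
        fix j assume j: "j \<in> blk p"
        then have "int (b j) + \<lfloor>t S j\<rfloor> = int (b' j) + \<lfloor>t S' j\<rfloor>"
          using eq_j[of j] blk_n by (auto simp: sh_def)
        then have "int (b j) - int (b' j) = \<lfloor>t S' j\<rfloor> - \<lfloor>t S j\<rfloor>" by linarith
        then have "real (b j) - real (b' j) = real_of_int \<lfloor>t S' j\<rfloor> - real_of_int \<lfloor>t S j\<rfloor>"
          by (metis of_int_diff of_int_of_nat_eq)
        then show "(real (b j) - real (b' j)) * y j
            = (real_of_int \<lfloor>t S' j\<rfloor> - real_of_int \<lfloor>t S j\<rfloor>) * y j" by simp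
      qed
      finally have lhs: "(\<Sum>j<n. (real (b j) - real (b' j)) * y j)
          = (\<Sum>j\<in>blk p. (real_of_int \<lfloor>t S' j\<rfloor> - real_of_int \<lfloor>t S j\<rfloor>) * y j)" .
      \<comment> \<open>Dropping the floors costs at most 1 per block coordinate, since the
        difference of two floor errors is at most 1 and \<open>y\<close> has entries at most 1. This
        is the summand \<open>2 * real k\<close> in the condition on \<open>lam\<close>.\<close>
      have "\<bar>(\<Sum>j\<in>blk p. (real_of_int \<lfloor>t S' j\<rfloor> - real_of_int \<lfloor>t S j\<rfloor>) * y j)
          - (\<Sum>j\<in>blk p. (t S' j - t S j) * y j)\<bar>
          = \<bar>\<Sum>j\<in>blk p. (real_of_int \<lfloor>t S' j\<rfloor> - real_of_int \<lfloor>t S j\<rfloor> - (t S' j - t S j)) * y j\<bar>"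
        by (simp add: sum_subtractf[symmetric] left_diff_distrib)
      also have "\<dots> \<le> (\<Sum>j\<in>blk p. \<bar>real_of_int \<lfloor>t S' j\<rfloor> - real_of_int \<lfloor>t S j\<rfloor> - (t S' j - t S j)\<bar> * \<bar>y j\<bar>)"
        unfolding abs_mult[symmetric] by (rule sum_abs)
      also have "\<dots> \<le> (\<Sum>j\<in>blk p. 1 * 1)"
      proof (intro sum_mono mult_mono)
        fix j show "\<bar>real_of_int \<lfloor>t S' j\<rfloor> - real_of_int \<lfloor>t S j\<rfloor> - (t S' j - t S j)\<bar> \<le> 1" by linarith
      qed (use y1 in auto)
      finally have err: "\<bar>(\<Sum>j\<in>blk p. (real_of_int \<lfloor>t S' j\<rfloor> - real_of_int \<lfloor>t S j\<rfloor>) * y j)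
          - (\<Sum>j\<in>blk p. (t S' j - t S j) * y j)\<bar> \<le> 2 * real k" by (simp add: card_blk)
      have "(\<Sum>j\<in>blk p. (t S' j - t S j) * y j) = lam * (sum a S' - sum a S)"
        using t_ip[OF S(1)] t_ip[OF S(2)] by (simp add: left_diff_distrib sum_subtractf right_diff_distrib)
      then have "\<bar>\<Sum>j\<in>blk p. (t S' j - t S j) * y j\<bar> = lam * \<bar>a l\<bar>"
        using sum_a lam_pos by (simp add: abs_mult abs_minus_commute)
      moreover have "lam * (cut_depth / 2) \<le> lam * \<bar>a l\<bar>" using al lam_pos by (intro mult_left_mono) auto
      ultimately have big: "2 * row_tol * (real n * real G) < \<bar>\<Sum>j<n. (real (b j) - real (b' j)) * y j\<bar>"
        using err lam unfolding lhs by linarith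
      have "(u (Suc l), y) \<in> set E" using E_nth[OF lr] by (simp add: y_def)
      then have "\<bar>ip d (row i b) y\<bar> \<le> row_tol" "\<bar>ip d (row i b') y\<bar> \<le> row_tol"
        using b by (auto simp: Z_def)
      then have "\<bar>ip d (row i b) y - ip d (row i b') y\<bar> \<le> 2 * row_tol" by linarith
      then have "\<bar>\<Sum>j<n. (real (b j) - real (b' j)) * y j\<bar> / (real n * real G) \<le> 2 * row_tol"
        unfolding ip_row_diff[OF i] by (simp add: abs_divide)
      then show False using big n_pos G_pos by (simp add: field_simps)
    qed
    moreover have "b = b'"
    proof (rule PiE_ext[of b "{..<n}" "\<lambda>_. {..<G}" b'])
      show "b \<in> {..<n} \<rightarrow>\<^sub>E {..<G}" "b' \<in> {..<n} \<rightarrow>\<^sub>E {..<G}" using b by (auto simp: Z_def rows_def)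
      show "b j = b' j" if "j \<in> {..<n}" for j using eq_j[of j] that \<open>S = S'\<close> by simp
    qed
    ultimately show "b = b' \<and> S = S'" by simp
  qed
  have "card (Z \<times> Pow {..<r - 1}) \<le> card Tgt"
  proof (rule card_inj_on_le[OF inj maps])
    show "finite Tgt" unfolding Tgt_def by (intro finite_PiE) auto
  qed
  also have "card Tgt = (\<Prod>j<n. if j \<in> blk p then G + 2 * R else G)"
    unfolding Tgt_def by (subst card_PiE) (auto intro!: prod.cong)
  also have "\<dots> = (\<Prod>j\<in>blk p. G + 2 * R) * (\<Prod>j\<in>{..<n} - blk p. G)"
    using blk_n by (subst prod.If_cases) (auto simp: Int_absorb1 Diff_eq)
  also have "\<dots> = (G + 2 * R) ^ (2 * k) * G ^ (n - 2 * k)"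
    using blk_n by (simp add: card_blk card_Diff_subset finite_subset[OF blk_n])
  finally show ?thesis by (simp add: card_cartesian_product card_Pow Z_def r_def)
qed

text \<open>With \<open>32 * R \<le> G\<close> the enlarged cube has side at most
  \<open>17 / 16 * G\<close> in \<open>2 * k = 8 * j\<close> coordinates, and
  \<open>17 ^ 8 \<le> 2 * 16 ^ 8\<close>, so enlarging costs a factor \<open>2 ^ j\<close>. Against
  the \<open>2 ^ (4 * j - 2)\<close> translates this leaves \<open>2 ^ (3 * j - 2)\<close>, which
  suffices as \<open>2 \<le> j\<close>.\<close>

lemma card_slab:
  assumes E: "explored p B E" and p: "p < P" and i: "i < n" and len: "length E = k - 1"
    and k: "k = 4 * j" "2 \<le> j"
    and lam: "2 * row_tol * (real n * real G) + 2 * real k < lam * (cut_depth / 2)"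
    and R: "lam * real k \<le> real R" "32 * R \<le> G"
  shows "card {b \<in> rows. \<forall>(u, x)\<in>set E. \<bar>ip d (row i b) x\<bar> \<le> row_tol} * 2 ^ (2 * j) \<le> G ^ n"
proof -
  define c where "c = card {b \<in> rows. \<forall>(u, x)\<in>set E. \<bar>ip d (row i b) x\<bar> \<le> row_tol}"
  have "0 \<le> 2 * row_tol * (real n * real G) + 2 * real k" using row_tol_pos by simp
  then have "0 < lam * (cut_depth / 2)" using lam by linarith
  then have "0 < lam" using cut_depth_pos by (simp add: zero_less_mult_iff)
  then have "lam * real (length E) \<le> lam * real k" using len by (intro mult_left_mono) auto
  then have "lam * real (length E) \<le> real R" using R(1) by linarith
  from card_slab_packing[OF E p i lam this]
  have pack: "c * 2 ^ (k - 2) \<le> (G + 2 * R) ^ (2 * k) * G ^ (n - 2 * k)"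
    using len by (simp add: c_def numeral_2_eq_2)
  have "2 * k * 1 \<le> 2 * k * P" using P_pos by (intro mult_le_mono) auto
  then have kn: "2 * k \<le> n" using kP_le by linarith
  have pow8: "a ^ (2 * k) = (a ^ 8) ^ j" for a :: nat
    unfolding k(1) power_mult[symmetric] by simp
  have "(16 * (G + 2 * R)) ^ (2 * k) \<le> (17 * G) ^ (2 * k)"
    using R(2) by (intro power_mono) auto
  also have "\<dots> = (17 ^ 8) ^ j * G ^ (2 * k)"
    by (simp only: power_mult_distrib pow8[of 17])
  also have "\<dots> \<le> (2 * 16 ^ 8) ^ j * G ^ (2 * k)"
    by (intro mult_right_mono power_mono) auto
  also have "\<dots> = 16 ^ (2 * k) * (2 ^ j * G ^ (2 * k))"
    unfolding pow8[of 16] power_mult_distrib by (simp only: ac_simps)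
  finally have "16 ^ (2 * k) * (G + 2 * R) ^ (2 * k) \<le> 16 ^ (2 * k) * (2 ^ j * G ^ (2 * k))"
    by (simp only: power_mult_distrib)
  then have "(G + 2 * R) ^ (2 * k) \<le> 2 ^ j * G ^ (2 * k)"
    by simp
  then have "(G + 2 * R) ^ (2 * k) * G ^ (n - 2 * k) \<le> 2 ^ j * G ^ (2 * k) * G ^ (n - 2 * k)"
    by (rule mult_right_mono) simp
  also have "\<dots> = 2 ^ j * G ^ n"
    using kn by (simp add: mult.assoc flip: power_add)
  finally have "c * 2 ^ (k - 2) \<le> 2 ^ j * G ^ n" using pack by linarith
  moreover have "(2::nat) ^ (k - 2) = 2 ^ j * 2 ^ (3 * j - 2)"
    using k by (simp flip: power_add)
  ultimately have "c * 2 ^ (3 * j - 2) \<le> G ^ n" by simp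
  moreover have "c * 2 ^ (2 * j) \<le> c * 2 ^ (3 * j - 2)"
    using k(2) by (intro mult_left_mono power_increasing) auto
  ultimately show ?thesis unfolding c_def by linarith
qed

section \<open>Runs determined by their start and the revealed rows\<close>

definition matrices :: "(nat \<Rightarrow> nat \<Rightarrow> nat) set" where "matrices = {..<n} \<rightarrow>\<^sub>E rows"

lemma card_matrices: "card matrices = (G ^ n) ^ n" and finite_matrices: "finite matrices"
  by (simp_all add: matrices_def card_PiE finite_PiE card_rows finite_rows)

lemma matrices_entry: "B \<in> matrices \<Longrightarrow> i < n \<Longrightarrow> l < n \<Longrightarrow> B i l < G"
  unfolding matrices_def rows_def by (drule PiE_mem, simp, drule PiE_mem) auto

lemma run_cong:
  assumes "\<And>i. i \<in> I \<Longrightarrow> B i = B' i"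
  shows "run I B = run I B'"
proof -
  have violates: "violates I B = violates I B'"
    unfolding violates_def using assms by (intro ext conj_cong) auto
  have "adv_oracle I B V x = adv_oracle I B' V x" for V x
  proof (cases "\<exists>i. violates I B x i")
    case True
    then have "violates I B x (LEAST i. violates I B x i)" by (rule LeastI_ex)
    then have "(LEAST i. violates I B x i) \<in> I" by (simp add: violates_def)
    then show ?thesis using assms unfolding adv_oracle_def violates Let_def by auto
  next
    case False
    then show ?thesis unfolding adv_oracle_def violates by auto
  qed
  then have "adv_step I B = adv_step I B'" by (simp add: adv_step_def)
  then show ?thesis by (intro ext) (simp add: run_def)
qed

text \<open>This contains every row index that the oracle uses in an answer. Queries outside the
  unit ball are counted as well, although their answer is no row; there is still at most one index
  per step.\<close>

definition revealed where
  "revealed B st \<tau> = {i. \<exists>t<\<tau>. \<exists>q. q = qry (fst (run {..<n} B st t)) \<and> (\<exists>i. violates {..<n} B q i) \<and>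
     i = (LEAST i. violates {..<n} B q i)}"

lemma revealed_subset: "revealed B st \<tau> \<subseteq> {..<n}"
proof
  fix i assume "i \<in> revealed B st \<tau>"
  then obtain q where "\<exists>i. violates {..<n} B q i" "i = (LEAST i. violates {..<n} B q i)"
    by (auto simp: revealed_def)
  then have "violates {..<n} B q i" using LeastI_ex by metis
  then show "i \<in> {..<n}" by (simp add: violates_def)
qed

lemma card_revealed: "card (revealed B st \<tau>) \<le> \<tau>"
proof -
  have "revealed B st \<tau> \<subseteq> (\<lambda>t. LEAST i. violates {..<n} B (qry (fst (run {..<n} B st t))) i) ` {..<\<tau>}"
    by (auto simp: revealed_def)
  then have "card (revealed B st \<tau>) \<le> card {..<\<tau>}" by (rule surj_card_le[rotated]) simp
  then show ?thesis by simp
qed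

lemma adv_oracle_subset:
  assumes "I \<subseteq> {..<n}" "\<exists>i. violates {..<n} B x i \<Longrightarrow> (LEAST i. violates {..<n} B x i) \<in> I"
  shows "adv_oracle I B V x = adv_oracle {..<n} B V x"
proof (cases "\<exists>i. violates {..<n} B x i")
  case True
  define m where "m = (LEAST i. violates {..<n} B x i)"
  have "violates {..<n} B x m" unfolding m_def using True by (rule LeastI_ex)
  then have m: "violates I B x m" using assms(2)[OF True] by (simp add: violates_def m_def)
  moreover have "m \<le> i" if "violates I B x i" for i
    unfolding m_def using that assms(1) by (intro Least_le) (auto simp: violates_def)
  ultimately have "(LEAST i. violates I B x i) = m" by (rule Least_equality)
  moreover have "\<exists>i. violates I B x i" using m by blast
  ultimately show ?thesis using True by (simp add: adv_oracle_def m_def)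
next
  case False
  moreover from this have "\<not> (\<exists>i. violates I B x i)" using assms(1) by (auto simp: violates_def)
  ultimately show ?thesis unfolding adv_oracle_def by (simp only: if_False)
qed

text \<open>The least violated row of each query is kept in \<open>I\<close>, so deleting the
  remaining rows changes no answer. Together with \<open>run_cong\<close>, the run depends only on
  its start and the entries of the revealed rows.\<close>

lemma run_revealed:
  assumes "I \<subseteq> {..<n}" "revealed B st \<tau> \<subseteq> I" "t \<le> \<tau>"
  shows "run I B st t = run {..<n} B st t"
  using assms(3)
proof (induction t)
  case (Suc t)
  obtain s V E where st: "run {..<n} B st t = (s, V, E)" by (cases "run {..<n} B st t")
  have "adv_oracle I B V (qry s) = adv_oracle {..<n} B V (qry s)"
  proof (rule adv_oracle_subset[OF assms(1)])
    assume "\<exists>i. violates {..<n} B (qry s) i"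
    then have "(LEAST i. violates {..<n} B (qry s) i) \<in> revealed B st \<tau>"
      unfolding revealed_def using Suc.prems st by (intro CollectI exI[of _ t]) auto
    then show "(LEAST i. violates {..<n} B (qry s) i) \<in> I" using assms(2) by blast
  qed
  then show ?case using Suc st by (simp add: run_Suc adv_step_def)
qed simp

text \<open>Only \<open>k - 1\<close> pairs can be required here: the last exploratory query of a period empties
  the list.\<close>

definition code_class where
  "code_class p s V I \<tau> = {B \<in> matrices. revealed B (s, V, []) \<tau> \<subseteq> I \<and>
     (\<exists>s' V' E. run {..<n} B (s, V, []) \<tau> = (s', V', E) \<and> length E = k - 1 \<and> explored p B E)}"

text \<open>Fix the rows in \<open>I\<close>. All matrices of the class with these rows share one
  run, hence one list \<open>E\<close>, and every other row is confined to the slabs of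
  \<open>E\<close>, a loss of \<open>2 * j\<close> bits. At least half of the rows lie outside
  \<open>I\<close>, which gives \<open>j * n\<close> bits.\<close>

lemma card_code_class:
  assumes p: "p < P" and I: "I \<subseteq> {..<n}" "card I \<le> n div 2" and k: "k = 4 * j" "2 \<le> j"
    and lam: "2 * row_tol * (real n * real G) + 2 * real k < lam * (cut_depth / 2)"
    and R: "lam * real k \<le> real R" "32 * R \<le> G"
  shows "card (code_class p s V I \<tau>) * 2 ^ (j * n) \<le> (G ^ n) ^ n"
proof -
  define w where "w = n - card I"
  have finI: "finite I" using I finite_subset by blast
  have cardI: "card I \<le> n" using I(2) by linarith
  define sub where "sub r = {B \<in> code_class p s V I \<tau>. restrict B I = r}" for r
  have sub_le: "card (sub r) * 2 ^ (2 * j * w) \<le> (G ^ n) ^ w" if r: "r \<in> I \<rightarrow>\<^sub>E rows" for r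
  proof (cases "sub r = {}")
    case False
    \<comment> \<open>An arbitrary member serves as representative; its list \<open>E\<close> will
      be that of every member.\<close>
    then obtain B0 where B0: "B0 \<in> sub r" by auto
    then obtain s0 V0 E where E: "run {..<n} B0 (s, V, []) \<tau> = (s0, V0, E)" "length E = k - 1"
      "explored p B0 E" and rev0: "revealed B0 (s, V, []) \<tau> \<subseteq> I"
      by (auto simp: sub_def code_class_def)
    define Z where "Z i = {b \<in> rows. \<forall>(u, x)\<in>set E. \<bar>ip d (row i b) x\<bar> \<le> row_tol}" for i
    have Z: "card (Z i) * 2 ^ (2 * j) \<le> G ^ n" if "i < n" for i
      unfolding Z_def by (rule card_slab[OF E(3) p that E(2) k lam R])
    have "sub r \<subseteq> (\<Pi>\<^sub>E i\<in>{..<n}. if i \<in> I then {r i} else Z i)"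
    proof
      fix B assume B: "B \<in> sub r"
      then obtain s1 V1 E1 where E1: "run {..<n} B (s, V, []) \<tau> = (s1, V1, E1)"
        "explored p B E1" and rev: "revealed B (s, V, []) \<tau> \<subseteq> I" and matrices: "B \<in> matrices"
        by (auto simp: sub_def code_class_def)
      have agree: "B i = B0 i" if "i \<in> I" for i
        using B B0 that by (auto simp: sub_def) (metis restrict_apply')
      have "run {..<n} B (s, V, []) \<tau> = run {..<n} B0 (s, V, []) \<tau>"
        using run_revealed[OF I(1) rev order_refl] run_revealed[OF I(1) rev0 order_refl]
          run_cong[of I B B0, OF agree] by simp
      then have "explored p B E" using E(1) E1 by simp
      then have "B i \<in> Z i" if "i < n" for i
        using that matrices by (fastforce simp: explored_def Z_def matrices_def)
      moreover have "B i = r i" if "i \<in> I" for i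
        using B that by (auto simp: sub_def)
      ultimately show "B \<in> (\<Pi>\<^sub>E i\<in>{..<n}. if i \<in> I then {r i} else Z i)"
        using matrices by (auto simp: matrices_def PiE_iff)
    qed
    then have "card (sub r) \<le> card (\<Pi>\<^sub>E i\<in>{..<n}. if i \<in> I then {r i} else Z i)"
      by (intro card_mono finite_PiE) (auto simp: Z_def finite_rows)
    also have "\<dots> = (\<Prod>i<n. if i \<in> I then 1 else card (Z i))"
      by (subst card_PiE) (auto intro!: prod.cong)
    also have "\<dots> = (\<Prod>i\<in>{..<n} - I. card (Z i))"
      by (subst prod.If_cases) (auto simp: Diff_eq)
    finally have "card (sub r) * 2 ^ (2 * j * w) \<le> (\<Prod>i\<in>{..<n} - I. card (Z i)) * 2 ^ (2 * j * w)"
      by simp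
    also have "\<dots> = (\<Prod>i\<in>{..<n} - I. card (Z i) * 2 ^ (2 * j))"
      using I(1) finI by (simp add: card_Diff_subset w_def power_mult prod.distrib)
    also have "\<dots> \<le> (\<Prod>i\<in>{..<n} - I. G ^ n)"
      using Z by (intro prod_mono) auto
    also have "\<dots> = (G ^ n) ^ w"
      using I(1) finI by (simp add: card_Diff_subset w_def)
    finally show ?thesis .
  qed simp
  have "code_class p s V I \<tau> \<subseteq> (\<Union>r\<in>I \<rightarrow>\<^sub>E rows. sub r)"
  proof
    fix B assume B: "B \<in> code_class p s V I \<tau>"
    then have "B i \<in> rows" if "i \<in> I" for i
      using I(1) that PiE_mem[of B "{..<n}" "\<lambda>_. rows" i] by (auto simp: code_class_def matrices_def)
    then have "restrict B I \<in> I \<rightarrow>\<^sub>E rows" by simp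
    then show "B \<in> (\<Union>r\<in>I \<rightarrow>\<^sub>E rows. sub r)" using B by (auto simp: sub_def)
  qed
  then have "card (code_class p s V I \<tau>) \<le> card (\<Union>r\<in>I \<rightarrow>\<^sub>E rows. sub r)"
    using finI finite_matrices by (intro card_mono finite_UN_I finite_PiE finite_rows)
      (auto simp: sub_def code_class_def)
  also have "\<dots> \<le> (\<Sum>r\<in>I \<rightarrow>\<^sub>E rows. card (sub r))"
    using finI by (intro card_UN_le finite_PiE finite_rows)
  finally have "card (code_class p s V I \<tau>) * 2 ^ (2 * j * w)
      \<le> (\<Sum>r\<in>I \<rightarrow>\<^sub>E rows. card (sub r) * 2 ^ (2 * j * w))"
    by (simp flip: sum_distrib_right)
  also have "\<dots> \<le> (\<Sum>r\<in>I \<rightarrow>\<^sub>E rows. (G ^ n) ^ w)"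
    by (intro sum_mono sub_le)
  also have "\<dots> = (G ^ n) ^ card I * (G ^ n) ^ w"
    using finI by (simp add: card_PiE card_rows)
  also have "\<dots> = (G ^ n) ^ n"
    using cardI by (simp add: w_def flip: power_add)
  finally have "card (code_class p s V I \<tau>) * 2 ^ (2 * j * w) \<le> (G ^ n) ^ n" .
  moreover have "j * n \<le> 2 * j * w"
  proof -
    have "n \<le> 2 * w" using I(2) by (simp add: w_def)
    then show ?thesis by (metis mult.assoc mult.commute mult_le_mono2)
  qed
  then have "card (code_class p s V I \<tau>) * 2 ^ (j * n) \<le> card (code_class p s V I \<tau>) * 2 ^ (2 * j * w)"
    by (intro mult_left_mono power_increasing) auto
  ultimately show ?thesis by linarith
qed

subsection \<open>Encoding matrices by short periods\<close>

text \<open>A vector supported in a single block costs \<open>2 * k\<close> grid values instead of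
  \<open>d\<close>; this keeps a list of \<open>k * P\<close> cuts within order
  \<open>k ^ 2 * P * log d\<close> bits.\<close>

definition cuts :: "vec set" where
  "cuts = (\<Union>p<P. (\<lambda>z i. if i \<in> blk p then real_of_int (z i) / real grid else 0) `
     (blk p \<rightarrow>\<^sub>E {- int grid..int grid}))"

lemma finite_blk: "finite (blk p)" by (simp add: blk_def)

lemma finite_cuts: "finite cuts"
  unfolding cuts_def by (intro finite_UN_I finite_imageI finite_PiE finite_blk) auto

lemma card_cuts: "card cuts \<le> P * (2 * grid + 1) ^ (2 * k)"
proof -
  have "card cuts \<le> (\<Sum>p<P. card ((\<lambda>z i. if i \<in> blk p then real_of_int (z i) / real grid else 0) `
     (blk p \<rightarrow>\<^sub>E {- int grid..int grid})))"
    unfolding cuts_def by (rule card_UN_le) simp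
  also have "\<dots> \<le> (\<Sum>p<P. card (blk p \<rightarrow>\<^sub>E {- int grid..int grid}))"
    by (intro sum_mono card_image_le finite_PiE finite_blk) auto
  also have "\<dots> = P * (2 * grid + 1) ^ (2 * k)"
  proof -
    have "nat (2 * int grid + 1) = 2 * grid + 1" by simp
    then show ?thesis by (simp add: card_PiE finite_blk card_blk)
  qed
  finally show ?thesis .
qed

lemma round_grid_in_cuts:
  assumes "p < P" "\<And>i. i \<notin> blk p \<Longrightarrow> u i = 0" "ip d u u = 1"
  shows "round_grid u \<in> cuts"
proof -
  define z where "z = (\<lambda>i\<in>blk p. \<lfloor>real grid * u i\<rfloor>)"
  have "\<lfloor>real grid * u i\<rfloor> \<in> {- int grid..int grid}" if "i \<in> blk p" for i
    using abs_coord_le_1_of_unit[OF assms(3), of i] blk_subset_d[OF assms(1)] that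
    by (intro floor_grid_bounds[of u i]) auto
  then have "z \<in> blk p \<rightarrow>\<^sub>E {- int grid..int grid}" by (auto simp: z_def)
  moreover have "round_grid u = (\<lambda>i. if i \<in> blk p then real_of_int (z i) / real grid else 0)"
    using assms(2) by (auto simp: round_grid_def z_def)
  ultimately show ?thesis using assms(1) unfolding cuts_def by blast
qed

section \<open>Short periods\<close>

text \<open>The count grows by at most one per step, so no value is skipped.\<close>

lemma first_time:
  assumes "c \<le> exploratory_count B T"
  shows "exploratory_count B (LEAST t. c \<le> exploratory_count B t) = c" "(LEAST t. c \<le> exploratory_count B t) \<le> T"
proof -
  define m where "m = (LEAST t. c \<le> exploratory_count B t)"
  have m: "c \<le> exploratory_count B m" unfolding m_def using assms by (rule LeastI)
  show "(LEAST t. c \<le> exploratory_count B t) \<le> T" using assms by (rule Least_le)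
  have "exploratory_count B m = c"
  proof (cases m)
    case 0
    then show ?thesis using m exploratory_count_le[of B 0] by simp
  next
    case (Suc m')
    then have "exploratory_count B m' < c" using not_less_Least[of m' "\<lambda>t. c \<le> exploratory_count B t"] by (simp add: m_def)
    then show ?thesis using m exploratory_count_Suc[of B m'] Suc by auto
  qed
  then show "exploratory_count B (LEAST t. c \<le> exploratory_count B t) = c" by (simp add: m_def)
qed

text \<open>Pigeonhole: if every period took at least \<open>Suc L\<close> steps, all of them
  together would take \<open>P * Suc L > T\<close>. The end point \<open>t1\<close> stops one
  exploratory query before the period closes, while its list of pairs is still there.\<close>

lemma short_period:
  assumes "k * P \<le> exploratory_count B T" "T \<le> P * L"
  shows "\<exists>p<P. \<exists>t0 t1. exploratory_count B t0 = p * k \<and> exploratory_count B t1 = p * k + (k - 1) \<and> t0 \<le> t1 \<and> t1 \<le> t0 + L"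
proof -
  define first where "first c = (LEAST t. c \<le> exploratory_count B t)" for c
  have exploratory_count_first: "exploratory_count B (first c) = c" "first c \<le> T" if "c \<le> k * P" for c
    using first_time[of c B T] that assms(1) by (auto simp: first_def)
  have first_mono: "first c \<le> first c'" if "c \<le> c'" "c' \<le> k * P" for c c'
    unfolding first_def[of c] using that exploratory_count_first[of c'] by (intro Least_le) auto
  have "\<exists>p<P. first (Suc p * k) \<le> first (p * k) + L"
  proof (rule ccontr)
    assume "\<not> ?thesis"
    then have gt: "first (p * k) + Suc L \<le> first (Suc p * k)" if "p < P" for p
      using that by (auto simp: not_le Suc_le_eq)
    have "p * Suc L \<le> first (p * k)" if "p \<le> P" for p
      using that
    proof (induction p)
      case (Suc p)
      then show ?case using gt[of p] by simp
    qed simp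
    then have "P * Suc L \<le> first (k * P)" by (metis mult.commute order_refl)
    also have "\<dots> \<le> P * L" using exploratory_count_first(2)[of "k * P"] assms(2) by simp
    finally show False using P_pos by simp
  qed
  then obtain p where p: "p < P" "first (Suc p * k) \<le> first (p * k) + L" by blast
  have le: "Suc p * k \<le> k * P" using p(1) by (metis Suc_leI mult.commute mult_le_mono2)
  have "first (p * k) \<le> first (p * k + (k - 1))" "first (p * k + (k - 1)) \<le> first (Suc p * k)"
    using le k_pos by (intro first_mono; simp)+
  then show ?thesis
    using p le k_pos exploratory_count_first(1)[of "p * k"] exploratory_count_first(1)[of "p * k + (k - 1)"]
    by (intro exI[of _ p] conjI exI[of _ "first (p * k)"] exI[of _ "first (p * k + (k - 1))"]) auto
qed

section \<open>Codes and the union bound\<close>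

definition histories :: "vec list set" where
  "histories = (\<Union>p<P. {V. set V \<subseteq> cuts \<and> length V = p * k})"

text \<open>A code names the revealed rows but not their entries; the entries are counted inside the
  class, in \<open>card_code_class\<close>. The bound \<open>n div 2\<close> on the length of a
  short period also bounds the number of revealed rows.\<close>

definition codes :: "(nat \<times> bool list \<times> vec list \<times> nat set \<times> nat) set" where
  "codes = {..<P} \<times> {s. length s = M} \<times> histories \<times> {I. I \<subseteq> {..<n} \<and> card I \<le> n div 2} \<times> {..n div 2}"

lemma finite_histories: "finite histories"
  unfolding histories_def using finite_cuts by (intro finite_UN_I finite_lists_length_eq) auto

lemma card_histories: "card histories \<le> P * (P * (2 * grid + 1) ^ (2 * k)) ^ (k * P)"
proof -
  define N where "N = P * (2 * grid + 1) ^ (2 * k)"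
  have N: "1 \<le> N" using P_pos by (simp add: N_def)
  have "card histories \<le> (\<Sum>p<P. card {V. set V \<subseteq> cuts \<and> length V = p * k})"
    unfolding histories_def by (rule card_UN_le) simp
  also have "\<dots> = (\<Sum>p<P. card cuts ^ (p * k))"
    by (simp add: card_lists_length_eq finite_cuts)
  also have "\<dots> \<le> (\<Sum>p<P. N ^ (k * P))"
  proof (rule sum_mono)
    fix p assume "p \<in> {..<P}"
    then have "p * k \<le> k * P" by simp
    have "card cuts ^ (p * k) \<le> N ^ (p * k)"
      using card_cuts by (intro power_mono) (auto simp: N_def)
    also have "\<dots> \<le> N ^ (k * P)" using N \<open>p * k \<le> k * P\<close> by (intro power_increasing)
    finally show "card cuts ^ (p * k) \<le> N ^ (k * P)" .
  qed
  finally show ?thesis by (simp add: N_def)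
qed

lemma finite_bool_lists: "finite {s :: bool list. length s = M}"
  and card_bool_lists: "card {s :: bool list. length s = M} = 2 ^ M"
  using finite_lists_length_eq[of "UNIV :: bool set" M] card_lists_length_eq[of "UNIV :: bool set" M]
  by auto

lemma finite_codes: "finite codes"
  unfolding codes_def using finite_bool_lists finite_histories by (intro finite_cartesian_product) auto

lemma card_codes:
  "card codes \<le> P * (2 ^ M * (P * (P * (2 * grid + 1) ^ (2 * k)) ^ (k * P) * (2 ^ n * (n div 2 + 1))))"
proof -
  have "card {I. I \<subseteq> {..<n} \<and> card I \<le> n div 2} \<le> card (Pow {..<n})"
    by (intro card_mono) auto
  then have "card {I. I \<subseteq> {..<n} \<and> card I \<le> n div 2} \<le> 2 ^ n" by (simp add: card_Pow)
  then show ?thesis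
    unfolding codes_def card_cartesian_product card_bool_lists
    using card_histories by (intro mult_le_mono) auto
qed

text \<open>Take the short period of the run. At its start the number of cuts is a multiple of
  \<open>k\<close>, so \<open>E\<close> is empty and \<open>s\<close> and \<open>V\<close> describe
  the whole state.\<close>

lemma matrices_subset_code_class:
  assumes B: "B \<in> matrices" and T: "T \<le> P * (n div 2)" "k * P \<le> exploratory_count B T"
  shows "\<exists>(p, s, V, I, \<tau>)\<in>codes. B \<in> code_class p s V I \<tau>"
proof -
  obtain p t0 t1 where p: "p < P" "exploratory_count B t0 = p * k" "exploratory_count B t1 = p * k + (k - 1)"
    "t0 \<le> t1" "t1 \<le> t0 + n div 2"
    using short_period[OF T(2,1)] by auto
  have "Suc p * k \<le> k * P" using p(1) by (metis Suc_leI mult.commute mult_le_mono2)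
  then have le: "exploratory_count B t0 \<le> k * P" "exploratory_count B t1 \<le> k * P"
    unfolding p(2,3) using k_pos by (simp_all only: mult_Suc)
  obtain s V E where st: "run {..<n} B init t0 = (s, V, E)" by (cases "run {..<n} B init t0")
  have inv0: "adv_inv B (s, V, E)" using adv_inv_run[OF le(1)] st by simp
  have lenV: "length V = p * k" using p(2) st by (simp add: exploratory_count_def)
  have E: "E = []" using inv0 lenV by (simp add: adv_inv_def)
  define \<tau> where "\<tau> = t1 - t0"
  have run1: "run {..<n} B (s, V, []) \<tau> = run {..<n} B init t1"
    using run_add[of "{..<n}" B init t0 \<tau>] p(4) st E by (simp add: \<tau>_def)
  obtain s' V' E' where st1: "run {..<n} B init t1 = (s', V', E')" by (cases "run {..<n} B init t1")
  have inv1: "adv_inv B (s', V', E')" using adv_inv_run[OF le(2)] st1 by simp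
  have lenV': "length V' = p * k + (k - 1)" using p(3) st1 by (simp add: exploratory_count_def)
  have "length V' = (k - 1) + k * p" using lenV' by (simp add: mult.commute)
  then have "length V' mod k = k - 1" "length V' div k = p"
    using k_pos by (simp_all only: mod_mult_self2 div_mult_self2) auto
  then have E': "length E' = k - 1" "explored p B E'" using inv1 by (auto simp: adv_inv_def)
  define I where "I = revealed B (s, V, []) \<tau>"
  have tau: "\<tau> \<le> n div 2" using p(5) by (simp add: \<tau>_def)
  then have I: "I \<subseteq> {..<n}" "card I \<le> n div 2"
    using revealed_subset card_revealed[of B "(s, V, [])" \<tau>] by (auto simp: I_def)
  obtain Us where Us: "V = map round_grid Us" "orthosys Us"
    "\<And>u. u \<in> set Us \<Longrightarrow> \<exists>p<P. \<forall>i. i \<notin> blk p \<longrightarrow> u i = 0"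
  proof -
    obtain Us where "V = map round_grid Us" "orthosys Us"
      "\<forall>u\<in>set Us. \<exists>p<length V div k. p < P \<and> (\<forall>i. i \<notin> blk p \<longrightarrow> u i = 0)"
      using inv0 unfolding E adv_inv_def by auto
    then show thesis by (intro that[of Us]) blast+
  qed
  have "round_grid u \<in> cuts" if "u \<in> set Us" for u
    using Us(2) Us(3)[OF that] that round_grid_in_cuts[of _ u] by (auto simp: orthosys_def)
  then have "set V \<subseteq> cuts" using Us(1) by auto
  then have "V \<in> histories" using lenV p(1) by (auto simp: histories_def)
  moreover have "length s = M" using inv0 by (simp add: adv_inv_def)
  ultimately have "(p, s, V, I, \<tau>) \<in> codes" using p(1) I tau by (simp add: codes_def)
  moreover have "B \<in> code_class p s V I \<tau>"
    using B E' run1 st1 by (auto simp: code_class_def I_def)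
  ultimately show ?thesis by blast
qed

text \<open>Union bound: the classes of all codes cover the matrices, and each class contains at
  most a fraction \<open>2 ^ - (j * n)\<close> of them.\<close>

lemma counting_bound:
  assumes T: "T \<le> P * (n div 2)" "\<And>B. B \<in> matrices \<Longrightarrow> k * P \<le> exploratory_count B T" and k: "k = 4 * j" "2 \<le> j"
    and lam: "2 * row_tol * (real n * real G) + 2 * real k < lam * (cut_depth / 2)"
    and R: "lam * real k \<le> real R" "32 * R \<le> G"
  shows "2 ^ (j * n) \<le> P * (2 ^ M * (P * (P * (2 * grid + 1) ^ (2 * k)) ^ (k * P) * (2 ^ n * (n div 2 + 1))))"
proof -
  define X where "X = (G ^ n) ^ n"
  have "matrices \<subseteq> (\<Union>(p, s, V, I, \<tau>)\<in>codes. code_class p s V I \<tau>)"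
    using matrices_subset_code_class T by fast
  then have "card matrices \<le> card (\<Union>(p, s, V, I, \<tau>)\<in>codes. code_class p s V I \<tau>)"
    using finite_codes finite_matrices by (intro card_mono finite_UN_I) (auto simp: code_class_def)
  also have "\<dots> \<le> (\<Sum>(p, s, V, I, \<tau>)\<in>codes. card (code_class p s V I \<tau>))"
    using card_UN_le[OF finite_codes, of "\<lambda>(p, s, V, I, \<tau>). code_class p s V I \<tau>"]
    by (simp add: case_prod_beta)
  finally have "X * 2 ^ (j * n) \<le> (\<Sum>(p, s, V, I, \<tau>)\<in>codes. card (code_class p s V I \<tau>) * 2 ^ (j * n))"
    unfolding card_matrices X_def[symmetric] by (simp add: case_prod_beta flip: sum_distrib_right)
  also have "\<dots> \<le> (\<Sum>c\<in>codes. X)"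
    unfolding X_def using card_code_class[OF _ _ _ k lam R] by (intro sum_mono) (auto simp: codes_def)
  finally have "X * 2 ^ (j * n) \<le> X * card codes" by simp
  moreover have "0 < X" using G_pos by (simp add: X_def)
  ultimately have "2 ^ (j * n) \<le> card codes" by simp
  then show ?thesis using card_codes by linarith
qed

text \<open>Each query adds at most one cut, so any matrix survives \<open>k * P\<close> queries.
  This serves the range of parameters where no full period fits the counting budget.\<close>

lemma resists_few_queries:
  assumes "T \<le> k * P"
  shows "\<exists>Q Orc. feas_instance d eps Q Orc \<and> (\<forall>t<T. query_at M qry upd Orc t \<notin> Q)"
  using resisting_instance_exists[of "\<lambda>_ _. 0" T] exploratory_count_le[of _ T] G_pos assms order_trans by blast

lemma resists_if_codes_few:
  assumes "T \<le> P * (n div 2)" "k = 4 * j" "2 \<le> j"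
    and "2 * row_tol * (real n * real G) + 2 * real k < lam * (cut_depth / 2)"
    and "lam * real k \<le> real R" "32 * R \<le> G"
    and "P * (2 ^ M * (P * (P * (2 * grid + 1) ^ (2 * k)) ^ (k * P) * (2 ^ n * (n div 2 + 1)))) < 2 ^ (j * n)"
  shows "\<exists>Q Orc. feas_instance d eps Q Orc \<and> (\<forall>t<T. query_at M qry upd Orc t \<notin> Q)"
proof -
  obtain B where "B \<in> matrices" "exploratory_count B T < k * P"
    using counting_bound[OF assms(1) _ assms(2-6)] assms(7) by (meson not_le)
  then show ?thesis using resisting_instance_exists[of B T] matrices_entry by simp
qed

end

subsection \<open>Choice of parameters\<close>

text \<open>Both sides of \<open>32 * R \<le> G\<close> grow linearly in \<open>G\<close>, so for
  large \<open>G\<close> only the coefficient of \<open>G\<close> in \<open>lam * k\<close> matters.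
  The order \<open>d ^ (- 5 / 2)\<close> of the accuracy turns it into
  \<open>(2 / 3) * (k / d) * (n / d) \<le> 1 / 96\<close>.\<close>

lemma packing_parameters:
  fixes d n k :: nat
  assumes "0 < d" "2 * n \<le> d" "32 * k \<le> d"
    and e: "e = 2 * (1 / (48 * real d ^ 2 * sqrt (real d)))" and g: "g = 1 / (4 * sqrt (real d))"
  shows "\<exists>(G::nat) lam (R::nat). 0 < G \<and> 2 * e * (real n * real G) + 2 * real k < lam * (g / 2) \<and>
    lam * real k \<le> real R \<and> 32 * R \<le> G"
proof -
  have g_pos: "0 < g" and e_pos: "0 < e" using assms(1) by (auto simp: g e)
  \<comment> \<open>These are the terms of \<open>lam * k + 1\<close> free of \<open>G\<close>;
    \<open>64 * c \<le> G\<close> is enough because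
    \<open>32 * (1 / 96 + 1 / 64) = 5 / 6\<close>.\<close>
  define c where "c = 2 * real k / g * (2 * real k + 1) + 1"
  have c: "1 \<le> c" using g_pos by (simp add: c_def)
  obtain G :: nat where G: "64 * c \<le> real G" using real_arch_simple by blast
  define lam where "lam = 2 / g * (2 * e * (real n * real G) + 2 * real k + 1)"
  define R where "R = nat \<lceil>lam * real k\<rceil>"
  have "0 \<le> lam * real k" using g_pos e_pos by (simp add: lam_def)
  then have R: "lam * real k \<le> real R" "real R \<le> lam * real k + 1"
    unfolding R_def by linarith+
  have ratio: "4 * real k * e * real n / g \<le> 1 / 96"
  proof -
    have "4 * real k * e * real n / g = (2 / 3) * (real k / real d) * (real n / real d)"
      using assms(1) by (simp add: e g power2_eq_square)
    also have "\<dots> \<le> (2 / 3) * (1 / 32) * (1 / 2)"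
      using assms(1-3) by (intro mult_mono) (auto simp: field_simps)
    finally show ?thesis by simp
  qed
  have "lam * real k + 1 = (4 * real k * e * real n / g) * real G + c"
    using g_pos by (simp add: lam_def c_def field_simps)
  also have "\<dots> \<le> (1 / 96) * real G + real G / 64"
    using ratio G by (intro add_mono mult_right_mono) auto
  finally have "32 * R \<le> G" using R(2) by linarith
  moreover have "0 < G" using G c by (cases G) auto
  moreover have "lam * (g / 2) = 2 * e * (real n * real G) + 2 * real k + 1"
    using g_pos by (simp add: lam_def)
  ultimately show ?thesis using R(1) by (intro exI[of _ G] exI[of _ lam] exI[of _ R]) auto
qed

text \<open>The number \<open>2 * grid + 1\<close> of grid values is at most
  \<open>17 * d ^ 2\<close>. For \<open>17 \<le> d\<close> the factor 17 is absorbed into a third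
  power of \<open>d\<close>, and \<open>ln 2 \<ge> 1 / 2\<close> doubles the constant.\<close>

lemma log_grid_le:
  fixes d :: nat
  assumes "17 \<le> d"
  shows "log 2 (17 * real d ^ 2) \<le> 6 * ln (real d)"
proof -
  have "1 \<le> ln (4::real)" using exp_le by (subst ln_ge_iff) auto
  then have ln2: "1 \<le> 2 * ln (2::real)" using ln_realpow[of 2 2] by simp
  have "ln (17 * real d ^ 2) = ln 17 + 2 * ln (real d)"
    using assms by (simp add: ln_mult ln_realpow)
  also have "ln 17 \<le> ln (real d)" using assms by simp
  finally have le: "ln (17 * real d ^ 2) \<le> 3 * ln (real d)" by simp
  have "0 \<le> ln (real d)" using assms by simp
  then have "3 * ln (real d) * 1 \<le> 3 * ln (real d) * (2 * ln 2)"
    using ln2 by (intro mult_left_mono) auto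
  then have "ln (17 * real d ^ 2) \<le> 6 * ln (real d) * ln 2" using le by simp
  then show ?thesis by (simp add: log_def pos_divide_le_eq)
qed

text \<open>Budget in units of \<open>k * n\<close>: available are \<open>1 / 4\<close>, since
  \<open>j = k / 4\<close>. The memory takes less than \<open>1 / 16\<close>, the list of cuts at
  most \<open>1 / 16\<close>, and the four factors bounded by \<open>2 ^ n\<close> at most
  \<open>1 / 12\<close>, since \<open>48 \<le> k\<close>.\<close>

lemma code_count_less:
  fixes d n k j P M D :: nat
  assumes "0 < P" "P \<le> n" "n \<le> d" "1 \<le> d" "k = 4 * j" "12 \<le> j" "16 * real M < real k * real n"
    and PL: "48 * log 2 (17 * real d ^ 2) * (real k * real P) \<le> real n" and D: "D = 8 * d ^ 2"
  shows "P * (2 ^ M * (P * (P * (2 * D + 1) ^ (2 * k)) ^ (k * P) * (2 ^ n * (n div 2 + 1)))) < 2 ^ (j * n)"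
proof -
  define L where "L = log 2 (17 * real d ^ 2)"
  have d2: "1 \<le> real d ^ 2" using assms(4) by simp
  have L: "2 powr L = 17 * real d ^ 2" using assms(4) by (simp add: L_def)
  have L_nonneg: "0 \<le> L" unfolding L_def by (subst zero_le_log_cancel_iff) (use d2 in linarith)+
  have n2: "real n \<le> 2 powr real n"
    using of_nat_less_two_power[of n, where 'a = real] by (simp add: powr_realpow)
  have P2: "real P \<le> 2 powr real n" using assms(2) n2 by linarith
  have "n div 2 + 1 \<le> 2 ^ n"
    using assms(1,2) less_exp[of n] by linarith
  then have n3: "real (n div 2 + 1) \<le> 2 powr real n"
    by (simp add: powr_realpow) (metis of_nat_Suc of_nat_le_iff of_nat_numeral of_nat_power Suc_eq_plus1)
  have base: "real P * (2 * real D + 1) ^ (2 * k) \<le> 2 powr (3 * L * real k)"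
  proof -
    have "real d \<le> real d ^ 2" using assms(4) by (intro self_le_power) auto
    then have "real P \<le> 2 powr L" unfolding L using assms(2,3) by linarith
    moreover have "2 * real D + 1 \<le> 2 powr L" unfolding L D using d2 by simp
    then have "(2 * real D + 1) ^ (2 * k) \<le> (2 powr L) ^ (2 * k)" by (intro power_mono) auto
    ultimately have "real P * (2 * real D + 1) ^ (2 * k) \<le> 2 powr L * (2 powr L) ^ (2 * k)"
      by (intro mult_mono) auto
    also have "\<dots> = 2 powr (L * (1 + 2 * real k))"
      by (simp add: powr_power powr_add[symmetric] distrib_left mult.commute)
    also have "\<dots> \<le> 2 powr (3 * L * real k)"
    proof -
      have "L * (1 + 2 * real k) \<le> L * (3 * real k)"
        using L_nonneg assms(5,6) by (intro mult_left_mono) auto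
      then show ?thesis by (simp add: mult.assoc mult.left_commute)
    qed
    finally show ?thesis .
  qed
  have "real (P * (2 ^ M * (P * (P * (2 * D + 1) ^ (2 * k)) ^ (k * P) * (2 ^ n * (n div 2 + 1)))))
      = real P * (2 powr real M * (real P * (real P * (2 * real D + 1) ^ (2 * k)) ^ (k * P)
          * (2 powr real n * real (n div 2 + 1))))"
    by (simp only: of_nat_mult of_nat_power of_nat_add of_nat_numeral of_nat_1 powr_realpow zero_less_numeral)
  also have "\<dots> \<le> 2 powr real n * (2 powr real M * (2 powr real n * (2 powr (3 * L * real k)) ^ (k * P)
          * (2 powr real n * 2 powr real n)))"
    using base P2 n3 by (intro mult_mono power_mono order_refl) (auto intro!: mult_nonneg_nonneg)
  also have "\<dots> = 2 powr (real M + 4 * real n + 3 * L * real k * (real k * real P))"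
    by (simp add: powr_power flip: powr_add) (simp add: algebra_simps)
  also have "\<dots> < 2 powr (real j * real n)"
  proof -
    have "real k * (48 * L * (real k * real P)) \<le> real k * real n"
      using PL by (intro mult_left_mono) (auto simp: L_def)
    then have "48 * (L * real k * (real k * real P)) \<le> real k * real n" by (simp add: ac_simps)
    moreover have "48 * real n \<le> real k * real n" using assms(5,6) by (intro mult_right_mono) auto
    ultimately have "real M + 4 * real n + 3 * (L * real k * (real k * real P)) < real k * real n / 4"
      using assms(7) by linarith
    then show ?thesis using assms(5) by (simp add: mult.assoc)
  qed
  also have "\<dots> = real (2 ^ (j * n))" by (simp add: powr_realpow flip: of_nat_mult)
  finally show ?thesis unfolding of_nat_less_iff .
qed

section \<open>Trade-off between memory and queries\<close>

theorem theorem2: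
  shows "\<exists>C>0. \<exists>k::nat. \<exists>d0::nat. \<forall>d\<ge>d0. \<forall>\<delta>::real. 0 \<le> \<delta> \<and> \<delta> \<le> 1 \<longrightarrow>
    (\<forall>M qry upd.
       mem_alg d M qry upd \<and>
       solves_feas d (1 / (48 * real d ^ 2 * sqrt (real d))) M qry upd \<longrightarrow>
       real M \<ge> real d powr (2 - \<delta>) \<or>
       (\<exists>Q Orc. feas_instance d (1 / (48 * real d ^ 2 * sqrt (real d))) Q Orc \<and>
          (\<forall>t::nat. real (Suc t) < C * real d powr (1 + \<delta>) / (ln (real d)) ^ k \<longrightarrow>
             query_at M qry upd Orc t \<notin> Q)))"
proof -
  \<comment> \<open>Small enough for both cases below: \<open>10 ^ 5 * C \<le> 1 / 16\<close> when
    \<open>P = 0\<close>, and \<open>1327104 * C \<le> 1\<close> otherwise.\<close>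
  define C :: real where "C = 1 / 10 ^ 7"
  have main: "\<exists>Q Orc. feas_instance d (1 / (48 * real d ^ 2 * sqrt (real d))) Q Orc \<and>
          (\<forall>t::nat. real (Suc t) < C * real d powr (1 + \<delta>) / (ln (real d)) ^ 1 \<longrightarrow>
             query_at M qry upd Orc t \<notin> Q)"
    if d: "17 \<le> d" and \<delta>: "0 \<le> \<delta>" "\<delta> \<le> 1" and alg: "mem_alg d M qry upd"
      and M: "real M < real d powr (2 - \<delta>)" for d M :: nat and \<delta> qry upd
  proof -
    define X where "X = C * real d powr (1 + \<delta>) / ln (real d)"
    define a where "a = real d powr (1 - \<delta>)"
    define n where "n = d div 2"
    \<comment> \<open>So \<open>k\<close> is at least \<open>48 * a\<close>, and
      \<open>M < a * d \<le> 3 * a * n\<close> yields \<open>16 * M < k * n\<close>; rounding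
      \<open>a\<close> up at most doubles it.\<close>
    define j where "j = 12 * nat \<lceil>a\<rceil>"
    define k where "k = 4 * j"
    define L where "L = log 2 (17 * real d ^ 2)"
    \<comment> \<open>The largest number of periods whose cuts fit the budget
      \<open>48 * L * k * P \<le> n\<close>.\<close>
    define P where "P = nat \<lfloor>real n / (48 * L * real k)\<rfloor>"
    have n: "2 * n \<le> d" "d \<le> 3 * n" "0 < n" using d by (auto simp: n_def)
    have a: "1 \<le> a" using d \<delta> by (simp add: a_def ge_one_powr_ge_zero)
    have ad: "real d powr (2 - \<delta>) = a * real d"
      using d powr_add[of "real d" "1 - \<delta>" 1] by (simp add: a_def)
    have da: "real d powr (1 + \<delta>) * a = real d ^ 2"
      using d powr_add[of "real d" "1 + \<delta>" "1 - \<delta>"] by (simp add: a_def powr_numeral)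
    have da': "real d powr (1 + \<delta>) = real d ^ 2 / a" using da a by (simp add: field_simps)
    have nat_a: "a \<le> real (nat \<lceil>a\<rceil>)" "real (nat \<lceil>a\<rceil>) \<le> 2 * a" using a by linarith+
    have k: "48 * a \<le> real k" "real k \<le> 96 * a" and j: "12 \<le> j"
      using nat_a a by (auto simp: k_def j_def) linarith
    have ln_pos: "0 < ln (real d)" using d by simp
    have L6: "L \<le> 6 * ln (real d)" unfolding L_def by (rule log_grid_le[OF d])
    have L1: "1 \<le> L"
    proof -
      have "1 \<le> real d ^ 2" using d by simp
      then have "log 2 2 \<le> log 2 (17 * real d ^ 2)" by (subst log_le_cancel_iff) linarith+
      then show ?thesis by (simp add: L_def)
    qed
    have survive: "\<exists>Q Orc. feas_instance d (1 / (48 * real d ^ 2 * sqrt (real d))) Q Orc \<and>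
          (\<forall>t::nat. real (Suc t) < C * real d powr (1 + \<delta>) / (ln (real d)) ^ 1 \<longrightarrow>
             query_at M qry upd Orc t \<notin> Q)"
      if "\<exists>Q Orc. feas_instance d (1 / (48 * real d ^ 2 * sqrt (real d))) Q Orc \<and>
          (\<forall>t<T. query_at M qry upd Orc t \<notin> Q)" "X \<le> real T" for T
    proof -
      have "t < T" if "real (Suc t) < C * real d powr (1 + \<delta>) / (ln (real d)) ^ 1" for t
        using that \<open>X \<le> real T\<close> by (simp add: X_def)
      then show ?thesis using that(1) by blast
    qed
    show ?thesis
    proof (cases "P = 0")
      \<comment> \<open>Here \<open>n < 48 * L * k\<close>, so \<open>a * ln d\<close> is at least
        of order \<open>d\<close> and \<open>X\<close> is at most \<open>d / 100\<close>. A single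
        period of \<open>d div 8\<close> exploratory queries with \<open>G = 1\<close> outlasts
        that.\<close>
      case True
      have k_pos: "0 < real k" using k a by linarith
      have "real n / (48 * L * real k) < 1" using True unfolding P_def by linarith
      then have "real n < 48 * (L * real k)" using k_pos L1 by (simp add: pos_divide_less_eq)
      also have "L * real k \<le> (6 * ln (real d)) * (96 * a)"
        using L6 k L1 ln_pos by (intro mult_mono) auto
      finally have "real n < 27648 * (ln (real d) * a)" by simp
      moreover have "0 \<le> ln (real d) * a" using ln_pos a by simp
      ultimately have "real d \<le> 100000 * (ln (real d) * a)" using n(2) by linarith
      then have "real d * real d \<le> real d * (100000 * (ln (real d) * a))"
        by (intro mult_left_mono) auto
      then have "C * real d powr (1 + \<delta>) / ln (real d) \<le> real d / 100"
        using ln_pos a by (simp add: da' C_def field_simps power2_eq_square)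
      also have "\<dots> \<le> real (d div 8)"
      proof -
        have "d \<le> 16 * (d div 8)" using d by linarith
        then show ?thesis by linarith
      qed
      finally have X: "X \<le> real (d div 8)" by (simp add: X_def)
      interpret hard_instance d n "d div 8" 1 1 M qry upd
        using n alg d by unfold_locales (auto simp: n_def)
      show ?thesis using survive[OF _ X] resists_few_queries[of "d div 8"] by (simp add: eps_def)
    next
      case False
      have k_pos: "0 < real k" using k a by linarith
      have y: "1 \<le> real n / (48 * L * real k)" using False unfolding P_def by linarith
      \<comment> \<open>A real number that is at least 1 is at most twice its floor.\<close>
      have P: "real P \<le> real n / (48 * L * real k)" "real n / (48 * L * real k) \<le> 2 * real P"
      proof -
        have "1 \<le> \<lfloor>real n / (48 * L * real k)\<rfloor>" using y by (simp only: le_floor_iff of_int_1)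
        then show "real P \<le> real n / (48 * L * real k)" "real n / (48 * L * real k) \<le> 2 * real P"
          unfolding P_def by linarith+
      qed
      have den: "0 < 48 * L * real k" using L1 k_pos by simp
      have kPn: "48 * L * (real k * real P) \<le> real n"
        using P(1) den by (simp add: pos_le_divide_eq ac_simps)
      have kP: "48 * (real k * real P) \<le> real n"
      proof -
        have "48 * 1 * (real k * real P) \<le> 48 * L * (real k * real P)"
          using L1 by (intro mult_right_mono) auto
        then show ?thesis using kPn by linarith
      qed
      then have kP': "48 * (k * P) \<le> n" by (simp flip: of_nat_mult of_nat_le_iff)
      have "k \<le> k * P" "P \<le> k * P" using False k_pos by auto
      then have kd: "32 * k \<le> d" and Pn: "P \<le> n" using kP' n(1) by linarith+
      have "0 < d" using d by linarith
      from packing_parameters[OF this n(1) kd refl refl]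
      obtain G lam R where G: "0 < G"
        "2 * (2 * (1 / (48 * real d ^ 2 * sqrt (real d)))) * (real n * real G) + 2 * real k
          < lam * (1 / (4 * sqrt (real d)) / 2)"
        "lam * real k \<le> real R" "32 * R \<le> G"
        by (elim exE conjE) (rule that)
      interpret hard_instance d n k P G M qry upd
      proof
        show "0 < n" "2 * n \<le> d" by (fact n)+
        show "0 < k" using k_pos by simp
        show "0 < P" using False by simp
        show "2 * k * P \<le> n" using kP' unfolding mult.assoc by linarith
        show "0 < G" by (fact G)
        show "mem_alg d M qry upd" by (fact alg)
      qed
      have "real d \<le> 3 * real n" using n(2) by linarith
      then have "a * real d \<le> a * (3 * real n)" using a by (intro mult_left_mono) linarith+
      then have "real M < a * (3 * real n)" using M unfolding ad by linarith
      then have "16 * real M < (48 * a) * real n" by simp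
      also have "\<dots> \<le> real k * real n" using k by (intro mult_right_mono) auto
      finally have Mk: "16 * real M < real k * real n" .
      \<comment> \<open>\<open>P\<close> is of order \<open>n / (a * ln d)\<close>, so
        \<open>P * (n div 2)\<close> is of order \<open>d ^ 2 / (a * ln d)\<close>, and
        \<open>d ^ 2 / a = d powr (1 + \<delta>)\<close>.\<close>
      have "X \<le> real (P * (n div 2))"
      proof -
        have "real n \<le> 96 * L * real k * real P" using P(2) den by (simp add: pos_divide_le_eq ac_simps)
        also have "\<dots> \<le> 96 * (6 * ln (real d)) * (96 * a) * real P"
          using L6 L1 k a ln_pos by (intro mult_mono) auto
        finally have np: "real n \<le> 55296 * (ln (real d) * a * real P)" by simp
        have "d \<le> 3 * n" "d \<le> 8 * (n div 2)" using d by (auto simp: n_def)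
        then have "real d \<le> 3 * real n" "real d \<le> 8 * real (n div 2)" by linarith+
        then have "real d * real d \<le> (3 * real n) * (8 * real (n div 2))" by (intro mult_mono) auto
        also have "\<dots> \<le> (3 * (55296 * (ln (real d) * a * real P))) * (8 * real (n div 2))"
          using np by (intro mult_right_mono mult_left_mono) auto
        finally have "real d ^ 2 \<le> 1327104 * (ln (real d) * a * (real P * real (n div 2)))"
          by (simp add: power2_eq_square)
        also have "\<dots> \<le> 10 ^ 7 * (ln (real d) * a * (real P * real (n div 2)))"
          using ln_pos a by (intro mult_right_mono) auto
        finally show ?thesis
          using ln_pos a by (simp add: X_def C_def da' field_simps)
      qed
      moreover have "\<exists>Q Orc. feas_instance d eps Q Orc \<and> (\<forall>t<P * (n div 2). query_at M qry upd Orc t \<notin> Q)"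
      proof (rule resists_if_codes_few[OF order_refl k_def])
        show "2 \<le> j" using j by simp
        show "2 * row_tol * (real n * real G) + 2 * real k < lam * (cut_depth / 2)"
          using G(2) by (simp only: row_tol_def eps_def cut_depth_def)
        show "lam * real k \<le> real R" "32 * R \<le> G" using G by auto
        show "P * (2 ^ M * (P * (P * (2 * grid + 1) ^ (2 * k)) ^ (k * P) * (2 ^ n * (n div 2 + 1))))
            < 2 ^ (j * n)"
          using False Pn n d j Mk kPn
          by (intro code_count_less[of P n d k j M grid]) (auto simp: k_def L_def grid_def)
      qed
      ultimately show ?thesis using survive[of "P * (n div 2)"] by (simp only: eps_def)
    qed
  qed
  have "0 < C" by (simp add: C_def)
  show ?thesis
  \<comment> \<open>One logarithm is lost, the one in \<open>L\<close>; the threshold 17 is that of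
    \<open>log_grid_le\<close>.\<close>
  proof (rule exI[of _ C], rule conjI[OF \<open>0 < C\<close>], rule exI[of _ 1], rule exI[of _ 17], intro allI impI)
    fix d :: nat and \<delta> :: real and M :: nat and qry upd
    assume "17 \<le> d" "0 \<le> \<delta> \<and> \<delta> \<le> 1" "mem_alg d M qry upd \<and>
       solves_feas d (1 / (48 * real d ^ 2 * sqrt (real d))) M qry upd"
    then show "real M \<ge> real d powr (2 - \<delta>) \<or>
       (\<exists>Q Orc. feas_instance d (1 / (48 * real d ^ 2 * sqrt (real d))) Q Orc \<and>
          (\<forall>t::nat. real (Suc t) < C * real d powr (1 + \<delta>) / (ln (real d)) ^ 1 \<longrightarrow>
             query_at M qry upd Orc t \<notin> Q))"
      using main[of d \<delta> M qry upd] by argo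
  qed
qed

end
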